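(* Let $X$ be an analytic subvariety of $(\mathbb C^n,0)$. Let $f\in\mathcal O_n$ with $f(0)=0$ be such that $\mu_X(f)<\infty$. Then $$\frac{\mu_X(f)}{\tau_X(f)}\leq r_f(J_X(f)),$$ and equality holds if and only if $\ker(\varphi_{f,J_X(f)})=\dfrac{\langle f^{r-1}\rangle+J_X(f)}{J_X(f)}$, where $r=r_f(J_X(f))$.
   Context: $\mathcal O_n$ is the ring of germs at $0$ of complex analytic functions $(\mathbb C^n,0)\to\mathbb C$. An analytic subvariety $X$ of $(\mathbb C^n,0)$ is the germ at $0$ of an analytic subvariety of $\mathbb C^n$, and $I(X)\subseteq\mathcal O_n$ is the ideal of germs vanishing on $X$. An element $\delta=(\delta_1,\dots,\delta_n)\in\mathcal O_n^n$ is identified with the derivation $\delta_1\frac{\partial}{\partial x_1}+\cdots+\delta_n\frac{\partial}{\partial x_n}$, and $\Theta_X=\{\delta\in\mathcal O_n^n:\delta(I(X))\subseteq I(X)\}$. For $f\in\mathcal O_n$, $J_X(f)$ is the ideal of $\mathcal O_n$ generated by $\{\delta(f):\delta\in\Theta_X\}$. The Bruce-Roberts' Milnor number is $\mu_X(f)=\dim_{\mathbb C}\mathcal O_n/J_X(f)$ and the Bruce-Roberts' Tjurina number is $\tau_X(f)=\dim_{\mathbb C}\mathcal O_n/(\langle f\rangle+J_X(f))$. For an ideal $I$ of a ring $R$ and $f\in R$: $r_f(I)$ is the minimum of those integers $r\geq 1$ such that $f^r\in I$ ($r_f(I)=\infty$ if no such $r$ exists), and $\varphi_{f,I}:R/I\to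 R/I$ is the multiplication morphism $g+I\mapsto fg+I$. *)

theory Defs
  imports
    "HOL-Analysis.Analysis"
    "HOL-Algebra.QuotRing"
    "HOL-Algebra.Embedded_Algebras"
begin

section \<open>Analytic functions of several complex variables\<close>

definition mpow :: "complex ^ 'n \<Rightarrow> ('n::finite \<Rightarrow> nat) \<Rightarrow> complex" where
  "mpow z \<alpha> = (\<Prod>i\<in>UNIV. (z $ i) ^ \<alpha> i)"

text \<open>Here \<open>c\<close> is indexed by multi-indices; the series is required to converge to \<open>f\<close>
  (unconditionally, equivalently absolutely) on a polydisc around \<open>a\<close>.\<close>

definition multi_analytic_at :: "(complex ^ 'n::finite \<Rightarrow> complex) \<Rightarrow> complex ^ 'n \<Rightarrow> bool" where
  "multi_analytic_at f a \<longleftrightarrow>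
     (\<exists>r>0. \<exists>c :: ('n \<Rightarrow> nat) \<Rightarrow> complex. \<forall>z. (\<forall>i. norm (z $ i - a $ i) < r) \<longrightarrow>
        ((\<lambda>\<alpha>. c \<alpha> * mpow (z - a) \<alpha>) has_sum f z) UNIV)"

definition partial_deriv :: "'n::finite \<Rightarrow> (complex ^ 'n \<Rightarrow> complex) \<Rightarrow> complex ^ 'n \<Rightarrow> complex" where
  "partial_deriv i f z = deriv (\<lambda>t. f (\<chi> j. if j = i then t else z $ j)) (z $ i)"

definition analytic_subvariety :: "(complex ^ 'n::finite) set \<Rightarrow> (complex ^ 'n) set \<Rightarrow> bool" where
  "analytic_subvariety U X \<longleftrightarrow> X \<subseteq> U \<and>
     (\<forall>a\<in>U. \<exists>V G. open V \<and> a \<in> V \<and> V \<subseteq> U \<and> finite G \<and>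
        (\<forall>g\<in>G. \<forall>z\<in>V. multi_analytic_at g z) \<and> X \<inter> V = {z\<in>V. \<forall>g\<in>G. g z = 0})"

lemma multi_analytic_at_0:
  "multi_analytic_at f 0 \<longleftrightarrow>
     (\<exists>r>0. \<exists>c. \<forall>z. (\<forall>i. norm (z $ i) < r) \<longrightarrow> ((\<lambda>\<alpha>. c \<alpha> * mpow z \<alpha>) has_sum f z) UNIV)"
  by (simp add: multi_analytic_at_def)

lemma mpow_add: "mpow z (\<lambda>i. \<alpha> i + \<beta> i) = mpow z \<alpha> * mpow z \<beta>"
  by (simp add: mpow_def power_add prod.distrib)

lemma multi_analytic_at_const: "multi_analytic_at (\<lambda>_. k) 0"
proof -
  have "((\<lambda>\<alpha>. (if \<alpha> = (\<lambda>_. 0) then k else 0) * mpow z \<alpha>) has_sum k) UNIV" for z :: "complex ^ 'a"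
  proof -
    have "((\<lambda>\<alpha>. (if \<alpha> = (\<lambda>_. 0) then k else 0) * mpow z \<alpha>) has_sum k) {\<lambda>_. 0}"
      by (rule has_sum_finiteI) (auto simp: mpow_def)
    then show ?thesis
      by (rule has_sum_cong_neutral[THEN iffD1, rotated 3]) auto
  qed
  then show ?thesis
    unfolding multi_analytic_at_0
    by (intro exI[of _ 1] conjI exI[of _ "\<lambda>\<alpha>. if \<alpha> = (\<lambda>_. 0) then k else 0"]) auto
qed

lemma multi_analytic_at_add:
  assumes "multi_analytic_at f 0" "multi_analytic_at g 0"
  shows "multi_analytic_at (\<lambda>z. f z + g z) 0"
proof -
  from assms(1) obtain r c where r: "r > 0"
    and c: "\<And>z. (\<forall>i. norm (z $ i) < r) \<Longrightarrow> ((\<lambda>\<alpha>. c \<alpha> * mpow z \<alpha>) has_sum f z) UNIV"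
    unfolding multi_analytic_at_0 by blast
  from assms(2) obtain s d where s: "s > 0"
    and d: "\<And>z. (\<forall>i. norm (z $ i) < s) \<Longrightarrow> ((\<lambda>\<alpha>. d \<alpha> * mpow z \<alpha>) has_sum g z) UNIV"
    unfolding multi_analytic_at_0 by blast
  have "((\<lambda>\<alpha>. (c \<alpha> + d \<alpha>) * mpow z \<alpha>) has_sum (f z + g z)) UNIV"
    if "\<forall>i. norm (z $ i) < min r s" for z
    using has_sum_add[OF c d, of z z] that by (simp add: ring_distribs)
  then show ?thesis
    unfolding multi_analytic_at_0 using r s
    by (intro exI[of _ "min r s"] conjI exI[of _ "\<lambda>\<alpha>. c \<alpha> + d \<alpha>"]) auto
qed

lemma finite_multi_index_le: "finite {\<alpha> :: 'n::finite \<Rightarrow> nat. \<forall>i. \<alpha> i \<le> \<gamma> i}"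
proof -
  have "{\<alpha> :: 'n \<Rightarrow> nat. \<forall>i. \<alpha> i \<le> \<gamma> i} = PiE UNIV (\<lambda>i. {..\<gamma> i})"
    by (auto simp: PiE_def Pi_def)
  then show ?thesis
    by (simp add: finite_PiE)
qed

lemma summable_on_times:
  fixes p q :: "'a \<Rightarrow> complex"
  assumes "(\<lambda>x. norm (p x)) summable_on UNIV" "(\<lambda>x. norm (q x)) summable_on UNIV"
  shows "(\<lambda>(x, y). p x * q y) summable_on UNIV \<times> UNIV"
proof (rule abs_summable_summable, unfold Infinite_Sum.abs_summable_on_Sigma_iff, intro conjI ballI)
  show "(\<lambda>y. norm (case (x, y) of (x, y) \<Rightarrow> p x * q y)) summable_on UNIV" for x
    using summable_on_cmult_right[OF assms(2), of "norm (p x)"] by (simp add: norm_mult)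
  have eq: "(\<Sum>\<^sub>\<infinity>y. norm (p x) * norm (q y)) = norm (p x) * (\<Sum>\<^sub>\<infinity>y. norm (q y))" for x
    by (rule infsum_cmult_right')
  have nn: "norm (\<Sum>\<^sub>\<infinity>y. norm (q y)) = (\<Sum>\<^sub>\<infinity>y. norm (q y))"
    using infsum_nonneg[of UNIV "\<lambda>y. norm (q y)"] by simp
  show "(\<lambda>x. norm (\<Sum>\<^sub>\<infinity>y. norm (case (x, y) of (x, y) \<Rightarrow> p x * q y))) summable_on UNIV"
    using summable_on_cmult_left[OF assms(1), of "\<Sum>\<^sub>\<infinity>y. norm (q y)"]
    by (simp add: norm_mult eq nn[unfolded real_norm_def] abs_mult)
qed

lemma multi_analytic_at_mult:
  fixes f g :: "complex ^ 'n::finite \<Rightarrow> complex"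
  assumes "multi_analytic_at f 0" "multi_analytic_at g 0"
  shows "multi_analytic_at (\<lambda>z. f z * g z) 0"
proof -
  from assms(1) obtain r c where r: "r > 0"
    and c: "\<And>z. (\<forall>i. norm (z $ i) < r) \<Longrightarrow> ((\<lambda>\<alpha>. c \<alpha> * mpow z \<alpha>) has_sum f z) UNIV"
    unfolding multi_analytic_at_0 by blast
  from assms(2) obtain s d where s: "s > 0"
    and d: "\<And>z. (\<forall>i. norm (z $ i) < s) \<Longrightarrow> ((\<lambda>\<alpha>. d \<alpha> * mpow z \<alpha>) has_sum g z) UNIV"
    unfolding multi_analytic_at_0 by blast
  define L where "L = (\<lambda>\<gamma> :: 'n \<Rightarrow> nat. {\<alpha> :: 'n \<Rightarrow> nat. \<forall>i. \<alpha> i \<le> \<gamma> i})"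
  define e where "e = (\<lambda>\<gamma>. \<Sum>\<alpha>\<in>L \<gamma>. c \<alpha> * d (\<lambda>i. \<gamma> i - \<alpha> i))"
  have "((\<lambda>\<gamma>. e \<gamma> * mpow z \<gamma>) has_sum (f z * g z)) UNIV"
    if z: "\<forall>i. norm (z $ i) < min r s" for z
  proof -
    let ?F = "\<lambda>\<alpha>. c \<alpha> * mpow z \<alpha>" and ?G = "\<lambda>\<alpha>. d \<alpha> * mpow z \<alpha>"
    have F: "(?F has_sum f z) UNIV" and G: "(?G has_sum g z) UNIV"
      using c d z by auto
    have abs: "(\<lambda>\<alpha>. norm (?F \<alpha>)) summable_on UNIV" "(\<lambda>\<beta>. norm (?G \<beta>)) summable_on UNIV"
      using F G by (auto simp: summable_on_iff_abs_summable_on_complex[symmetric] summable_on_def)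
    have sm: "(\<lambda>(\<alpha>, \<beta>). ?F \<alpha> * ?G \<beta>) summable_on UNIV \<times> UNIV"
      using summable_on_times[OF abs] .
    have tot: "((\<lambda>(\<alpha>, \<beta>). ?F \<alpha> * ?G \<beta>) has_sum (f z * g z)) (UNIV \<times> UNIV)"
    proof (rule has_sum_SigmaI[where g = "\<lambda>\<alpha>. ?F \<alpha> * g z"])
      show "((\<lambda>y. case (x, y) of (\<alpha>, \<beta>) \<Rightarrow> ?F \<alpha> * ?G \<beta>) has_sum ?F x * g z) UNIV" for x
        using has_sum_cmult_right[OF G, of "?F x"] by simp
      show "((\<lambda>\<alpha>. ?F \<alpha> * g z) has_sum f z * g z) UNIV"
        using has_sum_cmult_left[OF F, of "g z"] by simp
    qed (use sm in auto)
    have "((\<lambda>(\<gamma>, \<alpha>). c \<alpha> * d (\<lambda>i. \<gamma> i - \<alpha> i) * mpow z \<gamma>) has_sum (f z * g z)) (Sigma UNIV L)"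
    proof (subst has_sum_reindex_bij_witness[where T = "UNIV \<times> UNIV"
          and j = "\<lambda>(\<gamma>, \<alpha>). (\<alpha>, \<lambda>i. \<gamma> i - \<alpha> i)"
          and i = "\<lambda>(\<alpha>, \<beta>). (\<lambda>i. \<alpha> i + \<beta> i, \<alpha>)"
          and h = "\<lambda>(\<alpha>, \<beta>). ?F \<alpha> * ?G \<beta>"])
      fix p assume "p \<in> Sigma UNIV L"
      then obtain \<gamma> \<alpha> where p: "p = (\<gamma>, \<alpha>)" "\<And>i. \<alpha> i \<le> \<gamma> i"
        by (auto simp: L_def)
      have "mpow z \<gamma> = mpow z \<alpha> * mpow z (\<lambda>i. \<gamma> i - \<alpha> i)"
        using p by (simp flip: mpow_add)
      then show "(case (case p of (\<gamma>, \<alpha>) \<Rightarrow> (\<alpha>, \<lambda>i. \<gamma> i - \<alpha> i)) of (\<alpha>, \<beta>) \<Rightarrow> ?F \<alpha> * ?G \<beta>) =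
         (case p of (\<gamma>, \<alpha>) \<Rightarrow> c \<alpha> * d (\<lambda>i. \<gamma> i - \<alpha> i) * mpow z \<gamma>)"
        using p by simp
    qed (use tot in \<open>auto simp: L_def\<close>)
    then show ?thesis
    proof (rule has_sum_SigmaD)
      show "((\<lambda>\<alpha>. case (\<gamma>, \<alpha>) of (\<gamma>, \<alpha>) \<Rightarrow> c \<alpha> * d (\<lambda>i. \<gamma> i - \<alpha> i) * mpow z \<gamma>) has_sum
          e \<gamma> * mpow z \<gamma>) (L \<gamma>)" for \<gamma>
        by (rule has_sum_finiteI) (simp_all add: L_def finite_multi_index_le e_def sum_distrib_right)
    qed
  qed
  then show ?thesis
    unfolding multi_analytic_at_0 using r s
    by (intro exI[of _ "min r s"] conjI exI[of _ e]) auto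
qed

lemma multi_analytic_at_uminus:
  "multi_analytic_at f 0 \<Longrightarrow> multi_analytic_at (\<lambda>z. - f z) 0"
  using multi_analytic_at_mult[OF multi_analytic_at_const[of "-1"]] by simp

lemma multi_analytic_at_diff:
  "multi_analytic_at f 0 \<Longrightarrow> multi_analytic_at g 0 \<Longrightarrow> multi_analytic_at (\<lambda>z. f z - g z) 0"
  using multi_analytic_at_add[OF _ multi_analytic_at_uminus] by simp

lemma multi_analytic_at_partial_deriv:
  fixes f :: "complex ^ 'n::finite \<Rightarrow> complex"
  assumes "multi_analytic_at f 0"
  shows "multi_analytic_at (partial_deriv i f) 0"
proof -
  from assms obtain r c where r: "r > 0"
    and c: "\<And>z. (\<forall>j. norm (z $ j) < r) \<Longrightarrow> ((\<lambda>\<alpha>. c \<alpha> * mpow z \<alpha>) has_sum f z) UNIV"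
    unfolding multi_analytic_at_0 by blast
  define B where "B = {\<beta> :: 'n \<Rightarrow> nat. \<beta> i = 0}"
  define e where "e = (\<lambda>\<alpha>. of_nat (Suc (\<alpha> i)) * c (\<alpha>(i := Suc (\<alpha> i))))"
  have mpow_upd: "mpow (\<chi> j. if j = i then t else z $ j) (\<beta>(i := k)) = t ^ k * mpow z \<beta>"
    if "\<beta> \<in> B" for t z k and \<beta> :: "'n \<Rightarrow> nat"
  proof -
    have "mpow (\<chi> j. if j = i then t else z $ j) (\<beta>(i := k)) = t ^ k * (\<Prod>j\<in>UNIV - {i}. z $ j ^ \<beta> j)"
      unfolding mpow_def by (subst prod.remove[of _ i]) auto
    moreover have "mpow z \<beta> = (\<Prod>j\<in>UNIV - {i}. z $ j ^ \<beta> j)"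
      unfolding mpow_def using that by (subst prod.remove[of _ i]) (auto simp: B_def)
    ultimately show ?thesis by simp
  qed
  have "((\<lambda>\<alpha>. e \<alpha> * mpow z \<alpha>) has_sum partial_deriv i f z) UNIV"
    if z: "\<forall>j. norm (z $ j) < r" for z
  proof -
    define w where "w = z $ i"
    define a where "a = (\<lambda>k \<beta>. c (\<beta>(i := k)) * mpow z \<beta>)"
    define A where "A = (\<lambda>k. \<Sum>\<^sub>\<infinity>\<beta>\<in>B. a k \<beta>)"
    define u where "u = (\<lambda>t. \<chi> j. if j = i then t else z $ j)"
    have w: "norm w < r" using z by (simp add: w_def)
    have tot: "((\<lambda>(k, \<beta>). t ^ k * a k \<beta>) has_sum f (u t)) (UNIV \<times> B)" if t: "norm t < r" for t
    proof -
      have "((\<lambda>\<alpha>. c \<alpha> * mpow (u t) \<alpha>) has_sum f (u t)) UNIV"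
        by (rule c) (use t z in \<open>auto simp: u_def\<close>)
      then show ?thesis
      proof (subst has_sum_reindex_bij_witness[where T = UNIV and j = "\<lambda>(k, \<beta>). \<beta>(i := k)"
            and i = "\<lambda>\<alpha>. (\<alpha> i, \<alpha>(i := 0))" and h = "\<lambda>\<alpha>. c \<alpha> * mpow (u t) \<alpha>"])
      qed (auto simp: B_def a_def u_def mpow_upd[unfolded B_def])
    qed
    have a_sum: "(a k has_sum A k) B" for k
    proof -
      define t where "t = complex_of_real (r / 2)"
      have t: "norm t < r" "t \<noteq> 0" using r by (auto simp: t_def)
      have "(\<lambda>(k, \<beta>). t ^ k * a k \<beta>) summable_on UNIV \<times> B"
        using tot[OF t(1)] by (auto simp: summable_on_def)
      then have "(\<lambda>\<beta>. t ^ k * a k \<beta>) summable_on B"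
        by (drule_tac summable_on_SigmaD1) auto
      then have "a k summable_on B"
        using t summable_on_cmult_right[of "\<lambda>\<beta>. t ^ k * a k \<beta>" B "inverse (t ^ k)"]
        by (simp flip: mult.assoc)
      then show ?thesis
        unfolding A_def by (rule has_sum_infsum)
    qed
    have A_sums: "(\<lambda>k. A k * t ^ k) sums f (u t)" if t: "norm t < r" for t
    proof -
      have "((\<lambda>k. A k * t ^ k) has_sum f (u t)) UNIV"
      proof (rule has_sum_SigmaD[OF tot[OF t]])
        show "((\<lambda>\<beta>. case (k, \<beta>) of (k, \<beta>) \<Rightarrow> t ^ k * a k \<beta>) has_sum A k * t ^ k) B" for k
          using has_sum_cmult_right[OF a_sum[of k], of "t ^ k"] by (simp add: mult.commute)
      qed
      then show ?thesis by (rule has_sum_imp_sums)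
    qed
    have summ: "\<And>t. norm t < r \<Longrightarrow> summable (\<lambda>k. A k * t ^ k)"
      using A_sums by (auto simp: summable_def)
    have "((\<lambda>t. \<Sum>k. A k * t ^ k) has_field_derivative (\<Sum>k. diffs A k * w ^ k)) (at w)"
      by (rule termdiffs_strong'[OF summ w])
    then have "((\<lambda>t. f (u t)) has_field_derivative (\<Sum>k. diffs A k * w ^ k)) (at w)"
    proof (rule has_field_derivative_transform_within_open[where S = "ball 0 r"])
      show "(\<Sum>k. A k * t ^ k) = f (u t)" if "t \<in> ball 0 r" for t
        using sums_unique[OF A_sums[of t]] that by simp
    qed (use w in auto)
    then have D: "partial_deriv i f z = (\<Sum>k. diffs A k * w ^ k)"
      unfolding partial_deriv_def u_def w_def by (rule DERIV_imp_deriv)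
    let ?h = "\<lambda>(k, \<beta>). of_nat (Suc k) * w ^ k * a (Suc k) \<beta>"
    have sm: "?h summable_on UNIV \<times> B"
    proof -
      obtain \<rho> where \<rho>: "norm w < \<rho>" "\<rho> < r" using w dense by blast
      have \<rho>0: "\<rho> > 0" using \<rho> norm_ge_zero[of w] by linarith
      define q where "q = norm w / \<rho>"
      have q: "0 \<le> q" "q < 1" using \<rho> \<rho>0 by (auto simp: q_def)
      have "(\<lambda>k. real (Suc k) * q ^ k) \<longlonglongrightarrow> 0"
      proof -
        have "(\<lambda>k. real k * q ^ k) \<longlonglongrightarrow> 0"
          using powser_times_n_limit_0[of q] q by simp
        moreover have "(\<lambda>k. q ^ k) \<longlonglongrightarrow> 0"
          using q by (intro LIMSEQ_realpow_zero) auto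
        ultimately show ?thesis
          using tendsto_add[of "\<lambda>k. real k * q ^ k" 0 sequentially "\<lambda>k. q ^ k" 0]
          by (simp add: ring_distribs add.commute)
      qed
      then obtain M where M: "\<And>k. norm (real (Suc k) * q ^ k) \<le> M"
        using convergent_imp_Bseq[of "\<lambda>k. real (Suc k) * q ^ k"] 
        by (auto simp: convergent_def Bseq_def)
      have "(\<lambda>(k, \<beta>). complex_of_real \<rho> ^ k * a k \<beta>) summable_on UNIV \<times> B"
        using tot[of "complex_of_real \<rho>"] \<rho> \<rho>0 by (auto simp: summable_on_def)
      then have "(\<lambda>(k, \<beta>). complex_of_real \<rho> ^ k * a k \<beta>) summable_on ((\<lambda>(k, \<beta>). (Suc k, \<beta>)) ` (UNIV \<times> B))"
        by (rule summable_on_subset_banach) auto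
      then have "((\<lambda>(k, \<beta>). complex_of_real \<rho> ^ k * a k \<beta>) \<circ> (\<lambda>(k, \<beta>). (Suc k, \<beta>))) summable_on (UNIV \<times> B)"
        by (subst (asm) summable_on_reindex) (auto simp: inj_on_def)
      then have "(\<lambda>(k, \<beta>). complex_of_real \<rho> ^ Suc k * a (Suc k) \<beta>) summable_on (UNIV \<times> B)"
        by (simp add: o_def case_prod_unfold)
      then have "(\<lambda>p. norm (complex_of_real (M / \<rho>) * (case p of (k, \<beta>) \<Rightarrow> complex_of_real \<rho> ^ Suc k * a (Suc k) \<beta>)))
          summable_on (UNIV \<times> B)"
        unfolding summable_on_iff_abs_summable_on_complex[symmetric]
        by (rule summable_on_cmult_right)
      then have "(\<lambda>p. norm (?h p)) summable_on (UNIV \<times> B)"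
      proof (rule Infinite_Sum.abs_summable_on_comparison_test)
        fix p :: "nat \<times> ('n \<Rightarrow> nat)"
        obtain k \<beta> where p: "p = (k, \<beta>)" by fastforce
        have M0: "0 \<le> M" using M[of 0] norm_ge_zero order_trans by blast
        have "real (Suc k) * norm w ^ k = (real (Suc k) * q ^ k) * \<rho> ^ k"
          using \<rho>0 by (simp add: q_def power_divide)
        also have "\<dots> \<le> M * \<rho> ^ k"
          using M[of k] \<rho>0 q by (intro mult_right_mono) auto
        finally have *: "real (Suc k) * norm w ^ k \<le> M * \<rho> ^ k" .
        have "norm (?h p) = real (Suc k) * norm w ^ k * norm (a (Suc k) \<beta>)"
          by (simp only: p case_prod_conv norm_mult norm_power norm_of_nat)
        also have "\<dots> \<le> M * \<rho> ^ k * norm (a (Suc k) \<beta>)"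
          by (rule mult_right_mono[OF *]) simp
        also have "\<dots> = norm (complex_of_real (M / \<rho>) *
            (case p of (k, \<beta>) \<Rightarrow> complex_of_real \<rho> ^ Suc k * a (Suc k) \<beta>))"
          using \<rho>0 M0 by (simp add: p norm_mult norm_divide norm_power)
        finally show "norm (?h p) \<le> norm (complex_of_real (M / \<rho>) *
            (case p of (k, \<beta>) \<Rightarrow> complex_of_real \<rho> ^ Suc k * a (Suc k) \<beta>))" .
      qed
      then show ?thesis by (rule abs_summable_summable)
    qed
    have "(?h has_sum infsum ?h (UNIV \<times> B)) (UNIV \<times> B)"
      using sm by (rule has_sum_infsum)
    moreover from this have "((\<lambda>k. diffs A k * w ^ k) has_sum infsum ?h (UNIV \<times> B)) UNIV"
    proof (rule has_sum_SigmaD)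
      show "((\<lambda>\<beta>. ?h (k, \<beta>)) has_sum diffs A k * w ^ k) B" for k
        using has_sum_cmult_right[OF a_sum[of "Suc k"], of "of_nat (Suc k) * w ^ k"]
        by (simp add: diffs_def mult_ac)
    qed
    then have "infsum ?h (UNIV \<times> B) = partial_deriv i f z"
      unfolding D by (intro sums_unique has_sum_imp_sums)
    ultimately have "(?h has_sum partial_deriv i f z) (UNIV \<times> B)" by simp
    then show ?thesis
    proof (subst has_sum_reindex_bij_witness[where T = "UNIV \<times> B" and i = "\<lambda>(k, \<beta>). \<beta>(i := k)"
            and j = "\<lambda>\<alpha>. (\<alpha> i, \<alpha>(i := 0))" and h = ?h])
      fix \<alpha> :: "'n \<Rightarrow> nat"
      have "(\<chi> j. if j = i then w else z $ j) = z"
        by (simp add: vec_eq_iff w_def)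
      then have "mpow z \<alpha> = w ^ \<alpha> i * mpow z (\<alpha>(i := 0))"
        using mpow_upd[of "\<alpha>(i := 0)" w z "\<alpha> i"] by (simp add: B_def)
      then show "?h (\<alpha> i, \<alpha>(i := 0)) = e \<alpha> * mpow z \<alpha>"
        by (simp add: e_def a_def)
    qed (auto simp: B_def)
  qed
  then show ?thesis
    unfolding multi_analytic_at_0 using r by (intro exI[of _ r] conjI exI[of _ e]) auto
qed

lemma eventually_partial_deriv_cong:
  fixes f g :: "complex ^ 'n::finite \<Rightarrow> complex"
  assumes "eventually (\<lambda>z. f z = g z) (nhds a)"
  shows "eventually (\<lambda>z. partial_deriv i f z = partial_deriv i g z) (nhds a)"
proof -
  have "eventually (\<lambda>z. eventually (\<lambda>y. f y = g y) (nhds z)) (nhds a)"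
    using assms by (simp add: eventually_eventually)
  then show ?thesis
  proof eventually_elim
    case (elim z)
    let ?u = "\<lambda>t. (\<chi> j. if j = i then t else z $ j) :: complex ^ 'n"
    have "((\<lambda>t. if j = i then t else z $ j) \<longlongrightarrow> (if j = i then z $ i else z $ j)) (nhds (z $ i))" for j
      by (simp add: filterlim_ident)
    then have "(?u \<longlongrightarrow> ?u (z $ i)) (nhds (z $ i))"
      by (rule tendsto_vec_lambda)
    moreover have "?u (z $ i) = z" by (simp add: vec_eq_iff)
    ultimately have "filterlim ?u (nhds z) (nhds (z $ i))" by simp
    from this elim have "eventually (\<lambda>t. f (?u t) = g (?u t)) (nhds (z $ i))"
      by (rule eventually_compose_filterlim[rotated])
    then show ?case
      unfolding partial_deriv_def by (rule deriv_cong_ev) simp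
  qed
qed


section \<open>The ring of germs at the origin\<close>

definition germ_rel :: "(complex ^ 'n::finite \<Rightarrow> complex) \<Rightarrow> (complex ^ 'n \<Rightarrow> complex) \<Rightarrow> bool" where
  "germ_rel f g \<longleftrightarrow> multi_analytic_at f 0 \<and> multi_analytic_at g 0 \<and>
     eventually (\<lambda>z. f z = g z) (nhds 0)"

quotient_type (overloaded) 'n germ = "complex ^ 'n::finite \<Rightarrow> complex" / partial: germ_rel
proof (rule part_equivpI)
  show "\<exists>f. germ_rel f (f :: complex ^ 'n \<Rightarrow> complex)"
    using multi_analytic_at_const[of 0] by (auto simp: germ_rel_def)
  show "symp (germ_rel :: (complex ^ 'n \<Rightarrow> complex) \<Rightarrow> _)"
    by (auto simp: symp_def germ_rel_def eq_commute)
  show "transp (germ_rel :: (complex ^ 'n \<Rightarrow> complex) \<Rightarrow> _)"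
    by (auto simp: transp_def germ_rel_def elim: eventually_elim2)
qed

instantiation germ :: (finite) comm_ring_1
begin

lift_definition zero_germ :: "'a germ" is "\<lambda>_. 0"
  by (simp add: germ_rel_def multi_analytic_at_const)

lift_definition one_germ :: "'a germ" is "\<lambda>_. 1"
  by (simp add: germ_rel_def multi_analytic_at_const)

lift_definition plus_germ :: "'a germ \<Rightarrow> 'a germ \<Rightarrow> 'a germ" is "\<lambda>f g z. f z + g z"
  by (auto simp: germ_rel_def multi_analytic_at_add elim: eventually_elim2)

lift_definition uminus_germ :: "'a germ \<Rightarrow> 'a germ" is "\<lambda>f z. - f z"
  by (auto simp: germ_rel_def multi_analytic_at_uminus)

lift_definition minus_germ :: "'a germ \<Rightarrow> 'a germ \<Rightarrow> 'a germ" is "\<lambda>f g z. f z - g z"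
  by (auto simp: germ_rel_def multi_analytic_at_diff elim: eventually_elim2)

lift_definition times_germ :: "'a germ \<Rightarrow> 'a germ \<Rightarrow> 'a germ" is "\<lambda>f g z. f z * g z"
  by (auto simp: germ_rel_def multi_analytic_at_mult elim: eventually_elim2)

instance
proof
  fix a b c :: "'a germ"
  show "a * b * c = a * (b * c)"
    by transfer (simp add: germ_rel_def multi_analytic_at_mult mult.assoc)
  show "a * b = b * a"
    by transfer (simp add: germ_rel_def multi_analytic_at_mult mult.commute)
  show "1 * a = a"
    by transfer (simp add: germ_rel_def)
  show "a + b + c = a + (b + c)"
    by transfer (simp add: germ_rel_def multi_analytic_at_add add.assoc)
  show "a + b = b + a"
    by transfer (simp add: germ_rel_def multi_analytic_at_add add.commute)
  show "0 + a = a"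
    by transfer (simp add: germ_rel_def)
  show "- a + a = 0"
    by transfer (simp add: germ_rel_def multi_analytic_at_const)
  show "a - b = a + - b"
    by transfer (simp add: germ_rel_def multi_analytic_at_diff)
  show "(a + b) * c = a * c + b * c"
    by transfer (simp add: germ_rel_def multi_analytic_at_add multi_analytic_at_mult ring_distribs)
  show "(0 :: 'a germ) \<noteq> 1"
    by transfer (auto simp: germ_rel_def dest: eventually_nhds_x_imp_x)
qed

end

lift_definition germ_const :: "complex \<Rightarrow> 'n::finite germ" is "\<lambda>k _. k"
  by (simp add: germ_rel_def multi_analytic_at_const)

lift_definition germ_value :: "'n::finite germ \<Rightarrow> complex" is "\<lambda>f. f 0"
  by (auto simp: germ_rel_def dest: eventually_nhds_x_imp_x)

lift_definition germ_partial :: "'n::finite \<Rightarrow> 'n germ \<Rightarrow> 'n germ" is partial_deriv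
  by (auto simp: germ_rel_def multi_analytic_at_partial_deriv eventually_partial_deriv_cong)

lift_definition germ_vanishes_on :: "'n::finite germ \<Rightarrow> (complex ^ 'n) set \<Rightarrow> bool"
  is "\<lambda>f X. eventually (\<lambda>z. z \<in> X \<longrightarrow> f z = 0) (nhds 0)"
  by (auto simp: germ_rel_def fun_eq_iff elim: eventually_elim2)

definition germ_ring :: "'n::finite germ ring" (\<open>\<O>\<close>) where
  "\<O> = \<lparr>carrier = UNIV, mult = (*), one = 1, zero = 0, add = (+)\<rparr>"

lemma cring_germ_ring: "cring (\<O> :: 'n::finite germ ring)"
proof (rule cringI)
  show "abelian_group (\<O> :: 'n germ ring)"
    by (rule abelian_groupI)
       (auto simp: germ_ring_def add_ac intro: exI[of _ "- x" for x] left_minus)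
  show "comm_monoid (\<O> :: 'n germ ring)"
    by (rule comm_monoidI) (auto simp: germ_ring_def mult_ac)
qed (auto simp: germ_ring_def ring_distribs)


section \<open>Notions for an arbitrary ring\<close>

text \<open>The infimum of the empty set of extended naturals is \<open>\<infinity>\<close>.\<close>

definition power_index :: "('a, 'b) ring_scheme \<Rightarrow> 'a \<Rightarrow> 'a set \<Rightarrow> enat" where
  "power_index R f I = Inf {enat r |r :: nat. r \<ge> 1 \<and> f [^]\<^bsub>R\<^esub> r \<in> I}"

text \<open>The map \<open>g + I \<mapsto> f g + I\<close>; as in \<^const>\<open>rcoset_mult\<close>, the union over the
  representatives \<open>g\<close> of a coset is a union of equal cosets.\<close>

definition quot_mult :: "('a, 'b) ring_scheme \<Rightarrow> 'a set \<Rightarrow> 'a \<Rightarrow> 'a set \<Rightarrow> 'a set" where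
  "quot_mult R I f C = (\<Union>g\<in>C. I +>\<^bsub>R\<^esub> (f \<otimes>\<^bsub>R\<^esub> g))"

text \<open>The quotient \<open>K / I\<close> as a subset of \<open>R / I\<close>, for ideals \<open>I \<subseteq> K\<close>.\<close>

definition quot_ideal :: "('a, 'b) ring_scheme \<Rightarrow> 'a set \<Rightarrow> 'a set \<Rightarrow> 'a set set" where
  "quot_ideal R K I = (\<lambda>g. I +>\<^bsub>R\<^esub> g) ` K"


section \<open>Bruce--Roberts numbers\<close>

text \<open>Dimension of \<open>\<O> / I\<close> over \<open>\<complex>\<close>, the scalars being the classes of the constant germs
  (for \<open>I = \<O>\<close> everything collapses and the dimension is \<open>0\<close>).\<close>

definition quot_scalars :: "'n::finite germ set \<Rightarrow> 'n germ set set" where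
  "quot_scalars I = range (\<lambda>k. I +>\<^bsub>\<O>\<^esub> germ_const k)"

definition quot_dim :: "'n::finite germ set \<Rightarrow> enat" where
  "quot_dim I =
     (if ring.finite_dimension (\<O> Quot I) (quot_scalars I) (carrier (\<O> Quot I))
      then enat (ring.dim (\<O> Quot I) (quot_scalars I) (carrier (\<O> Quot I)))
      else \<infinity>)"

text \<open>A germ of a variety at \<open>0\<close> is given by any representative \<open>X\<close>; the definitions below
  depend only on \<open>X\<close> near \<open>0\<close>.\<close>

definition vanishing_ideal :: "(complex ^ 'n::finite) set \<Rightarrow> 'n germ set" where
  "vanishing_ideal X = {g. germ_vanishes_on g X}"

definition apply_derivation :: "'n::finite germ ^ 'n \<Rightarrow> 'n germ \<Rightarrow> 'n germ" where
  "apply_derivation \<delta> g = (\<Sum>i\<in>UNIV. \<delta> $ i * germ_partial i g)"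

definition Theta :: "(complex ^ 'n::finite) set \<Rightarrow> ('n germ ^ 'n) set" where
  "Theta X = {\<delta>. \<forall>g\<in>vanishing_ideal X. apply_derivation \<delta> g \<in> vanishing_ideal X}"

definition bruce_roberts_ideal :: "(complex ^ 'n::finite) set \<Rightarrow> 'n germ \<Rightarrow> 'n germ set" where
  "bruce_roberts_ideal X f = Idl\<^bsub>\<O>\<^esub> {apply_derivation \<delta> f |\<delta>. \<delta> \<in> Theta X}"

definition milnor :: "(complex ^ 'n::finite) set \<Rightarrow> 'n germ \<Rightarrow> enat" where
  "milnor X f = quot_dim (bruce_roberts_ideal X f)"

definition tjurina :: "(complex ^ 'n::finite) set \<Rightarrow> 'n germ \<Rightarrow> enat" where
  "tjurina X f = quot_dim (PIdl\<^bsub>\<O>\<^esub> f <+>\<^bsub>\<O>\<^esub> bruce_roberts_ideal X f)"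

end

theory Submission
  imports Defs
begin

text \<open>
  Put \<open>A = \<O> / J\<close>, a finite-dimensional algebra, and let \<open>\<phi>\<close> be multiplication by the class of \<open>f\<close>.
  The images \<open>\<phi>\<^sup>i A\<close> stabilise, so \<open>f\<^sup>i (1 - f a) \<in> J\<close> for some \<open>i\<close> and \<open>a\<close>; as \<open>f\<close> vanishes
  at \<open>0\<close>, the germ \<open>1 - f a\<close> is a unit, hence \<open>f\<^sup>i \<in> J\<close> and \<open>\<phi>\<close> is nilpotent.
  By rank-nullity \<open>\<tau> = dim (A / \<phi> A) = dim (ker \<phi>)\<close> and
  \<open>dim (\<phi>\<^sup>i A) = dim (\<phi>\<^sup>i A \<inter> ker \<phi>) + dim (\<phi>\<^sup>i\<^sup>+\<^sup>1 A)\<close>. Summing over \<open>i < r\<close>, where \<open>\<phi>\<^sup>r = 0\<close>, shows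
  that \<open>\<mu>\<close> is the sum of the \<open>r\<close> numbers \<open>dim (\<phi>\<^sup>i A \<inter> ker \<phi>) \<le> \<tau>\<close>. These decrease with \<open>i\<close> and the
  last one is \<open>dim (\<phi>\<^sup>r\<^sup>-\<^sup>1 A)\<close>, so \<open>\<mu> = r \<tau>\<close> exactly when \<open>\<phi>\<^sup>r\<^sup>-\<^sup>1 A = ker \<phi>\<close>.
\<close>


section \<open>Inverses of analytic germs\<close>

text \<open>The geometric series of \<open>\<Sum>i. \<phi> i\<close> with all powers multiplied out: words of length \<open>n\<close>
  enumerate the terms of the \<open>n\<close>-th power.\<close>

lemma prod_list_geometric:
  fixes \<phi> :: "'i \<Rightarrow> complex"
  assumes s: "(\<phi> has_sum s) UNIV" and S: "((\<lambda>i. norm (\<phi> i)) has_sum S) UNIV" and "S < 1"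
  shows "((\<lambda>w. prod_list (map \<phi> w)) has_sum 1 / (1 - s)) UNIV"
proof -
  define \<Phi> where "\<Phi> = (\<lambda>w. prod_list (map \<phi> w))"
  have S0: "0 \<le> S"
    using has_sum_nonneg[OF S] by simp
  \<comment> \<open>The length bound \<open>n\<close> only drives the induction. A nonempty word is
    a letter followed by a shorter word, so a bound \<open>x\<close> for the tails gives
    \<open>1 + S * x\<close> for \<open>F\<close>, and \<open>1 / (1 - S)\<close> is the fixed point
    of this map.\<close>
  have bound: "(\<Sum>w\<in>F. norm (\<Phi> w)) \<le> 1 / (1 - S)"
    if "finite F" "\<forall>w\<in>F. length w \<le> n" for F n
    using that
  proof (induction n arbitrary: F)
    case 0
    then have "F \<subseteq> {[]}" by auto
    then have "(\<Sum>w\<in>F. norm (\<Phi> w)) \<le> (\<Sum>w\<in>{[]}. norm (\<Phi> w))"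
      by (intro sum_mono2) auto
    also have "\<dots> \<le> 1 / (1 - S)"
      using S0 \<open>S < 1\<close> by (simp add: \<Phi>_def field_simps)
    finally show ?case .
  next
    case (Suc n)
    define A where "A = hd ` F"
    define F' where "F' = tl ` F"
    have fin: "finite A" "finite F'" using Suc.prems by (auto simp: A_def F'_def)
    have "F \<subseteq> insert [] ((\<lambda>(a, w). a # w) ` (A \<times> F'))"
    proof
      fix w assume "w \<in> F"
      then show "w \<in> insert [] ((\<lambda>(a, w). a # w) ` (A \<times> F'))"
        by (cases w) (force simp: A_def F'_def image_iff)+
    qed
    then have "(\<Sum>w\<in>F. norm (\<Phi> w)) \<le> (\<Sum>w\<in>insert [] ((\<lambda>(a, w). a # w) ` (A \<times> F')). norm (\<Phi> w))"
      using fin by (intro sum_mono2) auto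
    also have "\<dots> = 1 + (\<Sum>w\<in>(\<lambda>(a, w). a # w) ` (A \<times> F'). norm (\<Phi> w))"
      using fin by (subst sum.insert) (auto simp: \<Phi>_def)
    also have "(\<Sum>w\<in>(\<lambda>(a, w). a # w) ` (A \<times> F'). norm (\<Phi> w)) =
        (\<Sum>(a, w)\<in>A \<times> F'. norm (\<phi> a) * norm (\<Phi> w))"
      by (subst sum.reindex) (auto simp: inj_on_def \<Phi>_def norm_mult case_prod_unfold)
    also have "\<dots> = (\<Sum>a\<in>A. norm (\<phi> a)) * (\<Sum>w\<in>F'. norm (\<Phi> w))"
      by (simp add: sum_product sum.cartesian_product)
    also have "\<dots> \<le> S * (1 / (1 - S))"
    proof (rule mult_mono)
      show "(\<Sum>a\<in>A. norm (\<phi> a)) \<le> S"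
        using has_sum_mono2[OF has_sum_finite[OF fin(1)] S] by auto
      show "(\<Sum>w\<in>F'. norm (\<Phi> w)) \<le> 1 / (1 - S)"
        using Suc.prems fin by (intro Suc.IH) (auto simp: F'_def)
    qed (auto intro: sum_nonneg S0)
    also have "1 + S * (1 / (1 - S)) = 1 / (1 - S)"
      using \<open>S < 1\<close> by (simp add: field_simps)
    finally show ?case by simp
  qed
  have abs: "(\<lambda>w. norm (\<Phi> w)) summable_on UNIV"
  proof (rule nonneg_bdd_above_summable_on, simp, rule bdd_aboveI2)
    fix F :: "'i list set" assume "F \<in> {F. F \<subseteq> UNIV \<and> finite F}"
    then show "(\<Sum>w\<in>F. norm (\<Phi> w)) \<le> 1 / (1 - S)"
      by (intro bound[of F "Max (length ` F)"]) auto
  qed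
  define h where "h = infsum \<Phi> UNIV"
  have h: "(\<Phi> has_sum h) UNIV"
    using abs_summable_summable[OF abs] by (simp add: h_def)
  \<comment> \<open>Splitting off the first letter matches the nonempty words with pairs of a letter
    and a word; together with the empty word this yields \<open>h = 1 + s * h\<close>.\<close>
  have prod: "((\<lambda>(a, w). \<phi> a * \<Phi> w) has_sum (s * h)) (UNIV \<times> UNIV)"
  proof (rule has_sum_SigmaI[where g = "\<lambda>a. \<phi> a * h"])
    show "((\<lambda>y. case (x, y) of (a, w) \<Rightarrow> \<phi> a * \<Phi> w) has_sum \<phi> x * h) UNIV" for x
      using has_sum_cmult_right[OF h, of "\<phi> x"] by simp
    show "((\<lambda>a. \<phi> a * h) has_sum s * h) UNIV"
      using has_sum_cmult_left[OF s] by simp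
    have "\<Phi> summable_on (UNIV - {[]})"
      by (rule summable_on_subset_banach[OF has_sum_imp_summable[OF h]]) simp
    then show "(\<lambda>(a, w). \<phi> a * \<Phi> w) summable_on UNIV \<times> UNIV"
      by (subst summable_on_reindex_bij_witness[where T = "UNIV - {[]}"
            and i = "\<lambda>w. (hd w, tl w)" and j = "\<lambda>(a, w). a # w" and h = \<Phi>])
         (auto simp: \<Phi>_def neq_Nil_conv)
  qed
  have "(\<Phi> has_sum (s * h)) (UNIV - {[]})"
    by (subst has_sum_reindex_bij_witness[where T = "UNIV \<times> UNIV"
          and j = "\<lambda>w. (hd w, tl w)" and i = "\<lambda>(a, w). a # w" and h = "\<lambda>(a, w). \<phi> a * \<Phi> w"])
       (use prod in \<open>auto simp: \<Phi>_def neq_Nil_conv\<close>)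
  then have "(\<Phi> has_sum (\<Phi> [] + s * h)) (insert [] (UNIV - {[]}))"
    by (subst has_sum_insert) auto
  then have "h = 1 + s * h"
    using h by (simp add: insert_absorb \<Phi>_def has_sum_unique)
  moreover have "norm s \<le> S"
    using norm_infsum_bound[of \<phi> UNIV] infsumI[OF s] infsumI[OF S] S
    by (simp add: summable_on_def) blast
  with \<open>S < 1\<close> have "s \<noteq> 1" by auto
  ultimately have "h = 1 / (1 - s)" by (simp add: field_simps)
  with h show ?thesis by (simp add: \<Phi>_def)
qed

text \<open>With \<open>f = 1 - g\<close> and \<open>g\<close> without constant term,
  \<open>1 / f\<close> is the geometric series in \<open>g\<close>. On a small polydisc the norms of
  the terms of \<open>g\<close> sum to less than 1, so the series may be expanded over words of
  multi-indices and regrouped into a power series. The same bound gives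
  \<open>norm (1 - f z) < 1\<close>, hence \<open>f z \<noteq> 0\<close>.\<close>

lemma multi_analytic_at_inverse_1:
  fixes f :: "complex ^ 'n::finite \<Rightarrow> complex"
  assumes "multi_analytic_at f 0" and "f 0 = 1"
  shows "multi_analytic_at (\<lambda>z. 1 / f z) 0" and "eventually (\<lambda>z. f z \<noteq> 0) (nhds 0)"
proof -
  from assms(1) obtain r c where r: "r > 0"
    and c: "\<And>z. (\<forall>i. norm (z $ i) < r) \<Longrightarrow> ((\<lambda>\<alpha>. c \<alpha> * mpow z \<alpha>) has_sum f z) UNIV"
    unfolding multi_analytic_at_0 by blast
  define \<zeta> :: "'n \<Rightarrow> nat" where "\<zeta> = (\<lambda>_. 0)"
  have mpow_zeta: "mpow z \<zeta> = 1" for z :: "complex ^ 'n"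
    by (simp add: mpow_def \<zeta>_def)
  have "c \<zeta> = 1"
  proof -
    have *: "mpow (0 :: complex ^ 'n) \<alpha> = 0" if "\<alpha> \<noteq> \<zeta>" for \<alpha>
      using that by (auto simp: mpow_def \<zeta>_def fun_eq_iff)
    have "((\<lambda>\<alpha>. c \<alpha> * mpow 0 \<alpha>) has_sum c \<zeta>) {\<zeta>}"
      by (rule has_sum_finiteI) (auto simp: mpow_zeta)
    then have "((\<lambda>\<alpha>. c \<alpha> * mpow 0 \<alpha>) has_sum c \<zeta>) UNIV"
      by (rule has_sum_cong_neutral[THEN iffD1, rotated 3]) (auto simp: *)
    from has_sum_unique[OF this c] r \<open>f 0 = 1\<close> show ?thesis by simp
  qed
  \<comment> \<open>These are the coefficients of \<open>1 - f\<close>; the constant one vanishes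
    because \<open>c \<zeta> = f 0 = 1\<close>.\<close>
  define b where "b = (\<lambda>\<alpha>. if \<alpha> = \<zeta> then 0 else - c \<alpha>)"
  have b: "((\<lambda>\<alpha>. b \<alpha> * mpow z \<alpha>) has_sum (1 - f z)) UNIV" if "\<forall>i. norm (z $ i) < r" for z
  proof -
    have "((\<lambda>\<alpha>. if \<alpha> = \<zeta> then 1 else 0) has_sum (1 :: complex)) {\<zeta>}"
      by (rule has_sum_finiteI) auto
    then have "((\<lambda>\<alpha>. if \<alpha> = \<zeta> then 1 else 0) has_sum (1 :: complex)) UNIV"
      by (rule has_sum_cong_neutral[THEN iffD1, rotated 3]) auto
    from has_sum_add[OF this has_sum_cmult_right[OF c[OF that], of "-1"]]
    have "((\<lambda>\<alpha>. (if \<alpha> = \<zeta> then 1 else 0) + - (c \<alpha> * mpow z \<alpha>)) has_sum (1 - f z)) UNIV"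
      by simp
    moreover have "(\<lambda>\<alpha>. (if \<alpha> = \<zeta> then 1 else 0) + - (c \<alpha> * mpow z \<alpha>)) = (\<lambda>\<alpha>. b \<alpha> * mpow z \<alpha>)"
      using \<open>c \<zeta> = 1\<close> by (auto simp: b_def mpow_zeta)
    ultimately show ?thesis by simp
  qed
  have abs_b: "(\<lambda>\<alpha>. norm (b \<alpha> * mpow z \<alpha>)) summable_on UNIV" if "\<forall>i. norm (z $ i) < r" for z
    using b[OF that] by (auto simp: summable_on_iff_abs_summable_on_complex[symmetric] summable_on_def)
  have norm_mpow: "norm (mpow z \<alpha>) = (\<Prod>i\<in>UNIV. norm (z $ i) ^ \<alpha> i)" for z :: "complex ^ 'n" and \<alpha>
    by (simp add: mpow_def prod_norm[symmetric] norm_power)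
  define \<rho> where "\<rho> = r / 2"
  define v :: "complex ^ 'n" where "v = (\<chi> i. complex_of_real \<rho>)"
  have \<rho>: "0 < \<rho>" "\<rho> < r" using r by (auto simp: \<rho>_def)
  define M where "M = (\<Sum>\<^sub>\<infinity>\<alpha>. norm (b \<alpha> * mpow v \<alpha>))"
  have absv: "(\<lambda>\<alpha>. norm (b \<alpha> * mpow v \<alpha>)) summable_on UNIV"
    by (rule abs_b) (use \<rho> in \<open>simp add: v_def\<close>)
  have M: "0 \<le> M" unfolding M_def by (rule infsum_nonneg) simp
  \<comment> \<open>Shrinking the polyradius from \<open>\<rho>\<close> to \<open>t * \<rho>\<close>
    multiplies each bound by \<open>t\<close> to the total degree. Only terms of degree at least 1
    are present, so the norms sum to at most \<open>t * M = M / (M + 1) < 1\<close>.\<close>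
  define t where "t = 1 / (M + 1)"
  have t: "0 < t" "t \<le> 1" "t * M < 1" using M by (auto simp: t_def field_simps)
  have le: "norm (b \<alpha> * mpow z \<alpha>) \<le> t * norm (b \<alpha> * mpow v \<alpha>)"
    if z: "\<forall>i. norm (z $ i) < t * \<rho>" for z \<alpha>
  proof (cases "\<alpha> = \<zeta>")
    case False
    then obtain i where i: "\<alpha> i \<noteq> 0" by (auto simp: \<zeta>_def)
    have "norm (mpow z \<alpha>) \<le> (\<Prod>i\<in>UNIV. (t * \<rho>) ^ \<alpha> i)"
      unfolding norm_mpow using z by (intro prod_mono conjI power_mono) (auto intro: less_imp_le)
    also have "\<dots> = t ^ (\<Sum>i\<in>UNIV. \<alpha> i) * norm (mpow v \<alpha>)"
      using \<rho> by (simp add: norm_mpow v_def power_mult_distrib prod.distrib power_sum)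
    also have "\<dots> \<le> t ^ 1 * norm (mpow v \<alpha>)"
    proof (intro mult_right_mono power_decreasing)
      have "\<alpha> i \<le> (\<Sum>i\<in>UNIV. \<alpha> i)" by (rule member_le_sum) auto
      with i show "1 \<le> (\<Sum>i\<in>UNIV. \<alpha> i)" by simp
    qed (use t in auto)
    finally have "norm (b \<alpha>) * norm (mpow z \<alpha>) \<le> norm (b \<alpha>) * (t * norm (mpow v \<alpha>))"
      by (intro mult_left_mono) auto
    then show ?thesis by (simp add: norm_mult mult_ac)
  qed (simp add: b_def)
  have small: "t * \<rho> < r"
    using \<rho> t by (meson le_less_trans mult_left_le_one_le less_imp_le)
  \<comment> \<open>The exponent of the monomial obtained by multiplying out a word of
    multi-indices.\<close>
  define ms where "ms = (\<lambda>(w :: ('n \<Rightarrow> nat) list) i. \<Sum>\<alpha>\<leftarrow>w. \<alpha> i)"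
  define B where "B = (\<lambda>w. prod_list (map b w))"
  have list_eq: "prod_list (map (\<lambda>\<alpha>. b \<alpha> * mpow z \<alpha>) w) = B w * mpow z (ms w)" for z w
  proof (induction w)
    case Nil
    then show ?case by (simp add: B_def ms_def mpow_def)
  next
    case (Cons \<alpha> w)
    have "ms (\<alpha> # w) = (\<lambda>i. \<alpha> i + ms w i)" by (simp add: ms_def)
    then show ?case using Cons by (simp add: B_def mpow_add)
  qed
  have lt1: "(\<Sum>\<^sub>\<infinity>\<alpha>. norm (b \<alpha> * mpow z \<alpha>)) < 1"
    if z: "\<forall>i. norm (z $ i) < t * \<rho>" for z
  proof -
    have zr: "\<forall>i. norm (z $ i) < r" using z small by (meson less_trans)
    have "(\<Sum>\<^sub>\<infinity>\<alpha>. norm (b \<alpha> * mpow z \<alpha>)) \<le> (\<Sum>\<^sub>\<infinity>\<alpha>. t * norm (b \<alpha> * mpow v \<alpha>))"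
      using le[OF z] by (intro infsum_mono abs_b[OF zr] summable_on_cmult_right absv)
    also have "\<dots> = t * M" unfolding M_def by (rule infsum_cmult_right')
    finally show ?thesis using t by simp
  qed
  have inv: "((\<lambda>w. B w * mpow z (ms w)) has_sum 1 / f z) UNIV"
    if z: "\<forall>i. norm (z $ i) < t * \<rho>" for z
  proof -
    have zr: "\<forall>i. norm (z $ i) < r" using z small by (meson less_trans)
    from prod_list_geometric[OF b[OF zr] has_sum_infsum[OF abs_b[OF zr]] lt1[OF z]]
    show ?thesis by (simp add: list_eq)
  qed
  \<comment> \<open>The sum is infinite because the letter \<open>\<zeta>\<close> can be inserted
    freely into a word. Its convergence is read off from the expansion at a point \<open>u\<close>
    with nonzero coordinates, where \<open>mpow u (ms w)\<close> is a nonzero constant on the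
    fibre.\<close>
  define e where "e = (\<lambda>\<gamma>. \<Sum>\<^sub>\<infinity>w\<in>{w. ms w = \<gamma>}. B w)"
  have fibre: "(B has_sum e \<gamma>) {w. ms w = \<gamma>}" for \<gamma>
  proof -
    define u :: "complex ^ 'n" where "u = (\<chi> i. complex_of_real (t * \<rho> / 2))"
    have "(\<lambda>w. B w * mpow u (ms w)) summable_on UNIV"
      by (rule has_sum_imp_summable[OF inv])
         (use t \<rho> in \<open>simp add: u_def abs_mult flip: of_real_mult\<close>)
    then have "(\<lambda>w. B w * mpow u (ms w)) summable_on {w. ms w = \<gamma>}"
      by (rule summable_on_subset_banach) auto
    then have "(\<lambda>w. B w * mpow u (ms w) * inverse (mpow u \<gamma>)) summable_on {w. ms w = \<gamma>}"
      by (rule summable_on_cmult_left)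
    moreover have "mpow u \<gamma> \<noteq> 0"
      using t \<rho> by (simp add: mpow_def u_def)
    ultimately have "B summable_on {w. ms w = \<gamma>}"
      by (subst (asm) summable_on_cong[where g = B]) auto
    then show ?thesis unfolding e_def by (rule has_sum_infsum)
  qed
  have "((\<lambda>\<gamma>. e \<gamma> * mpow z \<gamma>) has_sum 1 / f z) UNIV"
    if z: "\<forall>i. norm (z $ i) < t * \<rho>" for z
  proof -
    have "((\<lambda>(\<gamma>, w). B w * mpow z \<gamma>) has_sum 1 / f z) (Sigma UNIV (\<lambda>\<gamma>. {w. ms w = \<gamma>}))"
      by (subst has_sum_reindex_bij_witness[where T = UNIV and j = snd
            and i = "\<lambda>w. (ms w, w)" and h = "\<lambda>w. B w * mpow z (ms w)"])
         (use inv[OF z] in auto)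
    then show ?thesis
      by (rule has_sum_SigmaD) (use has_sum_cmult_left[OF fibre] in auto)
  qed
  then show "multi_analytic_at (\<lambda>z. 1 / f z) 0"
    unfolding multi_analytic_at_0 using t \<rho>
    by (intro exI[of _ "t * \<rho>"] conjI exI[of _ e]) auto
  have "f z \<noteq> 0" if z: "norm z < t * \<rho>" for z
  proof -
    have zi: "\<forall>i. norm (z $ i) < t * \<rho>"
      using z by (meson Finite_Cartesian_Product.norm_nth_le le_less_trans)
    then have zr: "\<forall>i. norm (z $ i) < r" using small by (meson less_trans)
    have "norm (1 - f z) \<le> (\<Sum>\<^sub>\<infinity>\<alpha>. norm (b \<alpha> * mpow z \<alpha>))"
      using norm_infsum_bound[OF abs_b[OF zr]] infsumI[OF b[OF zr]] by simp
    also have "\<dots> < 1" by (rule lt1[OF zi])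
    finally show ?thesis by auto
  qed
  then show "eventually (\<lambda>z. f z \<noteq> 0) (nhds 0)"
    unfolding eventually_nhds_metric using t \<rho>
    by (intro exI[of _ "t * \<rho>"]) (auto simp: dist_norm)
qed

text \<open>Scaling by \<open>1 / u 0\<close> reduces to a germ of value 1, whose reciprocal is
  analytic. In other words, the germs of value 0 are the only candidates for non-units.\<close>

lemma germ_value_nonzero_imp_unit:
  fixes u :: "'n::finite germ"
  assumes "germ_value u \<noteq> 0"
  shows "\<exists>v. u * v = 1"
  using assms
proof (transfer)
  fix u :: "complex ^ 'n \<Rightarrow> complex"
  assume u: "germ_rel u u" and nz: "u 0 \<noteq> 0"
  define k where "k = 1 / u 0"
  have ma: "multi_analytic_at u 0" using u by (simp add: germ_rel_def)
  define v where "v = (\<lambda>z. k * (1 / (k * u z)))"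
  have "multi_analytic_at (\<lambda>z. k * u z) 0" and "k * u 0 = 1"
    by (intro multi_analytic_at_mult multi_analytic_at_const ma) (simp add: k_def nz)
  note inv = multi_analytic_at_inverse_1[OF this]
  from inv(1) have mv: "multi_analytic_at v 0"
    unfolding v_def by (intro multi_analytic_at_mult multi_analytic_at_const)
  from inv(2) have "eventually (\<lambda>z. u z * v z = 1) (nhds 0)"
    by eventually_elim (use nz in \<open>simp add: v_def k_def\<close>)
  then show "\<exists>v\<in>{f. germ_rel f f}. germ_rel (\<lambda>z. u z * v z) (\<lambda>_. 1)"
    using mv ma by (intro bexI[of _ v]) (auto simp: germ_rel_def multi_analytic_at_mult multi_analytic_at_const)
qed

section \<open>Dimensions of kernels and images\<close>

text \<open>Rank-nullity. Two rings and a map \<open>\<sigma>\<close> of scalars are allowed because \<open>\<O> / I\<close> and \<open>\<O> / J\<close>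
  contain different copies of the complex numbers.\<close>

lemma dimension_semilinear:
  fixes R (structure) and S (structure)
  assumes "ring R" and "ring S" and K: "subfield K R" and \<sigma>: "\<sigma> ` K = L"
    and T_closed: "\<And>x. x \<in> carrier R \<Longrightarrow> T x \<in> carrier S"
    and T_add: "\<And>x y. x \<in> carrier R \<Longrightarrow> y \<in> carrier R \<Longrightarrow> T (x \<oplus>\<^bsub>R\<^esub> y) = T x \<oplus>\<^bsub>S\<^esub> T y"
    and T_smult: "\<And>k x. k \<in> K \<Longrightarrow> x \<in> carrier R \<Longrightarrow> T (k \<otimes>\<^bsub>R\<^esub> x) = \<sigma> k \<otimes>\<^bsub>S\<^esub> T x"
    and dim: "ring.dimension R n K E"
  shows "\<exists>p q. ring.dimension R p K {x \<in> E. T x = \<zero>\<^bsub>S\<^esub>} \<and> ring.dimension S q L (T ` E) \<and> n = p + q"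
proof -
  interpret R: ring R by fact
  interpret S: ring S by fact
  have KR: "K \<subseteq> carrier R" using subfieldE(3)[OF K] .
  have T_0: "T \<zero>\<^bsub>R\<^esub> = \<zero>\<^bsub>S\<^esub>"
    using T_add[of "\<zero>\<^bsub>R\<^esub>" "\<zero>\<^bsub>R\<^esub>"] T_closed[of "\<zero>\<^bsub>R\<^esub>"] S.add.r_cancel_one by simp
  have T_neg: "T (\<ominus>\<^bsub>R\<^esub> x) = \<ominus>\<^bsub>S\<^esub> T x" if "x \<in> carrier R" for x
  proof (rule S.minus_equality[symmetric])
    show "T (\<ominus>\<^bsub>R\<^esub> x) \<oplus>\<^bsub>S\<^esub> T x = \<zero>\<^bsub>S\<^esub>"
      using T_add[of "\<ominus>\<^bsub>R\<^esub> x" x] that T_0 by (simp add: R.l_neg)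
  qed (use that T_closed in auto)
  show ?thesis
    using dim
  proof (induction n arbitrary: E)
    case 0
    then have "E = {\<zero>\<^bsub>R\<^esub>}" by (rule R.dimension_zero[OF K])
    then have "{x \<in> E. T x = \<zero>\<^bsub>S\<^esub>} = {\<zero>\<^bsub>R\<^esub>}" "T ` E = {\<zero>\<^bsub>S\<^esub>}" using T_0 by auto
    then show ?case using R.zero_dim S.zero_dim by (metis add_0)
  next
    case (Suc n)
    from R.dimension_backwards[OF K Suc.prems] obtain v E' where v: "v \<in> carrier R" "v \<notin> E'"
      and E': "R.dimension n K E'" and E: "E = R.line_extension K v E'"
      by blast
    note sub = R.space_subgroup_props[OF K E']
    let ?Z = "\<lambda>E. {x \<in> E. T x = \<zero>\<^bsub>S\<^esub>}"
    from Suc.IH[OF E'] obtain p q where p: "R.dimension p K (?Z E')"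
      and q: "S.dimension q L (T ` E')" and n: "n = p + q" by blast
    have cl: "x \<in> carrier R" if "x \<in> E'" for x using sub(1) that by blast
    have kc: "k \<in> carrier R" if "k \<in> K" for k using KR that by blast
    show ?case
    proof (cases "T v \<in> T ` E'")
      case True
      then obtain e0 where e0: "e0 \<in> E'" "T v = T e0" by auto
      \<comment> \<open>This vector lies in the kernel and extends \<open>E'\<close> to the same
        space as \<open>v\<close> does, so it supplies the new dimension of the kernel.\<close>
      define w where "w = v \<ominus>\<^bsub>R\<^esub> e0"
      have wc: "w \<in> carrier R" using v e0 cl by (simp add: w_def)
      have vw: "v = w \<oplus>\<^bsub>R\<^esub> e0" using v cl[OF e0(1)] unfolding w_def by algebra
      have "T w = \<zero>\<^bsub>S\<^esub>"
        using v cl[OF e0(1)] T_closed e0 by (simp add: w_def R.minus_eq T_add T_neg S.r_neg)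
      have split: "k \<otimes>\<^bsub>R\<^esub> v \<oplus>\<^bsub>R\<^esub> e = k \<otimes>\<^bsub>R\<^esub> w \<oplus>\<^bsub>R\<^esub> (k \<otimes>\<^bsub>R\<^esub> e0 \<oplus>\<^bsub>R\<^esub> e)"
        if "k \<in> K" "e \<in> E'" for k e
        unfolding vw using wc cl[OF e0(1)] cl[OF that(2)] kc[OF that(1)] by algebra
      have Tw: "T (k \<otimes>\<^bsub>R\<^esub> w \<oplus>\<^bsub>R\<^esub> e) = T e" if "k \<in> K" "e \<in> E'" for k e
      proof -
        \<comment> \<open>\<open>\<sigma> k\<close> is not assumed to lie in the carrier of
          \<open>S\<close>, so the equation is obtained by applying \<open>T\<close> to
          \<open>k\<close> times zero.\<close>
        have "\<sigma> k \<otimes>\<^bsub>S\<^esub> \<zero>\<^bsub>S\<^esub> = \<zero>\<^bsub>S\<^esub>"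
          using T_smult[OF that(1) R.zero_closed] T_0 kc[OF that(1)] by simp
        then show ?thesis
          using that kc cl wc T_closed by (simp add: T_add T_smult \<open>T w = \<zero>\<^bsub>S\<^esub>\<close>)
      qed
      have in_E: "u \<in> E \<longleftrightarrow> (\<exists>k\<in>K. \<exists>e\<in>E'. u = k \<otimes>\<^bsub>R\<^esub> w \<oplus>\<^bsub>R\<^esub> e)" for u
      proof
        assume "u \<in> E"
        then obtain k e where "k \<in> K" "e \<in> E'" "u = k \<otimes>\<^bsub>R\<^esub> v \<oplus>\<^bsub>R\<^esub> e"
          unfolding E R.line_extension_mem_iff by blast
        then show "\<exists>k\<in>K. \<exists>e\<in>E'. u = k \<otimes>\<^bsub>R\<^esub> w \<oplus>\<^bsub>R\<^esub> e"
          using split sub(3,5) e0 by metis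
      next
        assume "\<exists>k\<in>K. \<exists>e\<in>E'. u = k \<otimes>\<^bsub>R\<^esub> w \<oplus>\<^bsub>R\<^esub> e"
        then obtain k e where ke: "k \<in> K" "e \<in> E'" "u = k \<otimes>\<^bsub>R\<^esub> w \<oplus>\<^bsub>R\<^esub> e" by blast
        have *: "e \<ominus>\<^bsub>R\<^esub> k \<otimes>\<^bsub>R\<^esub> e0 \<in> E'"
          using ke e0 sub by (simp add: R.minus_eq)
        have "u = k \<otimes>\<^bsub>R\<^esub> v \<oplus>\<^bsub>R\<^esub> (e \<ominus>\<^bsub>R\<^esub> k \<otimes>\<^bsub>R\<^esub> e0)"
          unfolding vw ke(3) using wc cl[OF e0(1)] cl[OF ke(2)] kc[OF ke(1)] by algebra
        then show "u \<in> E" unfolding E R.line_extension_mem_iff using ke(1) * by blast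
      qed
      have "?Z E = R.line_extension K w (?Z E')"
        unfolding set_eq_iff R.line_extension_mem_iff by (auto simp: in_E Tw) (use Tw in metis)+
      moreover have "w \<notin> ?Z E'"
        using vw v(2) sub(3) e0(1) by auto
      ultimately have "R.dimension (Suc p) K (?Z E)"
        using R.Suc_dim[OF wc _ p] by simp
      moreover have "\<zero>\<^bsub>R\<^esub> \<in> K"
        using subringE(2)[OF subfieldE(1)[OF K]] .
      then have "E' \<subseteq> E"
        unfolding subset_eq in_E using wc cl by (metis R.l_null R.l_zero)
      then have "T ` E = T ` E'"
        by (auto simp: in_E Tw)
      ultimately show ?thesis using q n by (intro exI[of _ "Suc p"] exI[of _ q]) simp
    next
      case False
      have "k = \<zero>\<^bsub>R\<^esub>"
        if k: "k \<in> K" and e: "e \<in> E'" and 0: "T (k \<otimes>\<^bsub>R\<^esub> v \<oplus>\<^bsub>R\<^esub> e) = \<zero>\<^bsub>S\<^esub>" for k e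
      proof (rule ccontr)
        assume "k \<noteq> \<zero>\<^bsub>R\<^esub>"
        then have i: "inv\<^bsub>R\<^esub> k \<in> K" and ik: "inv\<^bsub>R\<^esub> k \<otimes>\<^bsub>R\<^esub> k = \<one>\<^bsub>R\<^esub>"
          using R.subfield_m_inv[OF K] k by auto
        have "T (k \<otimes>\<^bsub>R\<^esub> v) \<oplus>\<^bsub>S\<^esub> T e = \<zero>\<^bsub>S\<^esub>"
          using 0 v kc[OF k] cl[OF e] by (simp add: T_add)
        then have "T (k \<otimes>\<^bsub>R\<^esub> v) = T (\<ominus>\<^bsub>R\<^esub> e)"
          using v kc[OF k] cl[OF e] T_closed by (simp add: T_neg S.minus_equality[symmetric])
        then have "T (inv\<^bsub>R\<^esub> k \<otimes>\<^bsub>R\<^esub> (k \<otimes>\<^bsub>R\<^esub> v)) = T (inv\<^bsub>R\<^esub> k \<otimes>\<^bsub>R\<^esub> (\<ominus>\<^bsub>R\<^esub> e))"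
          using i v kc[OF k] cl[OF e] by (simp add: T_smult)
        moreover have "inv\<^bsub>R\<^esub> k \<otimes>\<^bsub>R\<^esub> (k \<otimes>\<^bsub>R\<^esub> v) = v"
          using ik v kc[OF k] kc[OF i] by (simp flip: R.m_assoc)
        ultimately have "T v = T (inv\<^bsub>R\<^esub> k \<otimes>\<^bsub>R\<^esub> (\<ominus>\<^bsub>R\<^esub> e))" by simp
        with False i e sub(4,5) show False by blast
      qed
      moreover have "\<zero>\<^bsub>R\<^esub> \<in> K"
        using subringE(2)[OF subfieldE(1)[OF K]] .
      ultimately have "?Z E = ?Z E'"
        unfolding set_eq_iff E mem_Collect_eq R.line_extension_mem_iff
        using v cl by (metis R.l_null R.l_zero)
      moreover have "T ` E = S.line_extension L (T v) (T ` E')"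
      proof -
        have "T (k \<otimes>\<^bsub>R\<^esub> v \<oplus>\<^bsub>R\<^esub> e) = \<sigma> k \<otimes>\<^bsub>S\<^esub> T v \<oplus>\<^bsub>S\<^esub> T e" if "k \<in> K" "e \<in> E'" for k e
          using that v kc cl by (simp add: T_add T_smult)
        then show ?thesis
          unfolding set_eq_iff S.line_extension_mem_iff image_iff E Bex_def R.line_extension_mem_iff
          using \<sigma> by (auto simp: image_iff) metis+
      qed
      ultimately show ?thesis
        using p S.Suc_dim[OF T_closed[OF v(1)] False q] n
        by (intro exI[of _ p] exI[of _ "Suc q"]) simp
    qed
  qed
qed

text \<open>A basis of \<open>F\<close> is an independent list in \<open>E\<close>, so its length is
  at most \<open>q\<close>; if the length equals \<open>q\<close>, the list spans
  \<open>E\<close>.\<close>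

lemma (in ring) subspace_dimension_le:
  assumes K: "subfield K R" and p: "dimension p K F" and q: "dimension q K E" and "F \<subseteq> E"
  shows "p \<le> q" and "p = q \<Longrightarrow> F = E"
proof -
  obtain Us where Us: "independent K Us" "length Us = p" "Span K Us = F" "set Us \<subseteq> carrier R"
    using exists_base[OF K p] by blast
  have "set Us \<subseteq> E"
    using Span_base_incl[OF K Us(4)] Us(3) \<open>F \<subseteq> E\<close> by blast
  with Us show "p \<le> q" "p = q \<Longrightarrow> F = E"
    using independent_length_le_dimension[OF K q] independent_length_eq_dimension[OF K q] by auto
qed

section \<open>Powers of a multiplication map on a finite-dimensional algebra\<close>

context cring
begin

text \<open>Rank-nullity for multiplication by \<open>\<phi>\<close>, which is linear over
  \<open>K\<close> by commutativity; both rings coincide and the scalars stay fixed.\<close>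

lemma dimension_mult:
  assumes K: "subfield K R" and \<phi>: "\<phi> \<in> carrier R" and "dimension n K E"
  shows "\<exists>p q. dimension p K {x \<in> E. \<phi> \<otimes> x = \<zero>} \<and> dimension q K ((\<otimes>) \<phi> ` E) \<and> n = p + q"
proof (rule dimension_semilinear[where \<sigma> = id])
  show "\<phi> \<otimes> (k \<otimes> x) = id k \<otimes> (\<phi> \<otimes> x)" if "k \<in> K" "x \<in> carrier R" for k x
    using that subfieldE(3)[OF K] \<phi> by (auto simp: m_lcomm)
qed (use assms in \<open>auto simp: r_distr ring_axioms\<close>)

lemma power_image_Suc:
  assumes "\<phi> \<in> carrier R"
  shows "(\<otimes>) (\<phi> [^] Suc i) ` carrier R = (\<otimes>) \<phi> ` (\<otimes>) (\<phi> [^] i) ` carrier R"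
    and "(\<otimes>) (\<phi> [^] Suc i) ` carrier R \<subseteq> (\<otimes>) (\<phi> [^] i) ` carrier R"
proof -
  show "(\<otimes>) (\<phi> [^] Suc i) ` carrier R = (\<otimes>) \<phi> ` (\<otimes>) (\<phi> [^] i) ` carrier R"
    using assms by (auto simp: image_image m_comm m_assoc m_lcomm intro!: image_cong)
  show "(\<otimes>) (\<phi> [^] Suc i) ` carrier R \<subseteq> (\<otimes>) (\<phi> [^] i) ` carrier R"
    using assms by (auto simp: m_assoc)
qed

text \<open>Rank-nullity for \<open>\<phi>\<close> restricted to the image of its
  \<open>i\<close>-th power: \<open>d i\<close> is the dimension of that image, \<open>k i\<close>
  that of the part killed by \<open>\<phi>\<close>, and the image of the restriction is the next
  power image.\<close>

lemma power_image_dimension: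
  assumes K: "subfield K R" and \<phi>: "\<phi> \<in> carrier R" and m: "dimension m K (carrier R)"
  obtains d k where "d 0 = m"
    and "\<And>i. dimension (d i) K ((\<otimes>) (\<phi> [^] i) ` carrier R)"
    and "\<And>i. dimension (k i) K {x \<in> (\<otimes>) (\<phi> [^] i) ` carrier R. \<phi> \<otimes> x = \<zero>}"
    and "\<And>i. d i = k i + d (Suc i)"
proof -
  let ?E = "\<lambda>i. (\<otimes>) (\<phi> [^] i) ` carrier R"
  have E0: "?E (0::nat) = carrier R" by auto
  have "\<exists>n. dimension n K (?E i)" for i :: nat
  proof (induction i)
    case 0
    then show ?case using m E0 by metis
  next
    case (Suc i)
    then show ?case using dimension_mult[OF K \<phi>] power_image_Suc(1)[OF \<phi>] by metis
  qed
  then obtain d where d: "\<And>i::nat. dimension (d i) K (?E i)" by metis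
  have "\<exists>k. dimension k K {x \<in> ?E i. \<phi> \<otimes> x = \<zero>} \<and> d i = k + d (Suc i)" for i
    using dimension_mult[OF K \<phi> d[of i]] d[of "Suc i"] dimension_is_inj[OF K]
    unfolding power_image_Suc(1)[OF \<phi>] by blast
  then obtain k where "\<And>i. dimension (k i) K {x \<in> ?E i. \<phi> \<otimes> x = \<zero>} \<and> d i = k i + d (Suc i)"
    by metis
  moreover have "d 0 = m" using d[of 0] m dimension_is_inj[OF K] E0 by metis
  ultimately show thesis using d that by blast
qed

text \<open>The images decrease. At an index where their dimension is least, the next image is a
  subspace of the same dimension, hence equal.\<close>

lemma power_image_stabilises:
  assumes K: "subfield K R" and \<phi>: "\<phi> \<in> carrier R" and m: "dimension m K (carrier R)"
  shows "\<exists>i::nat. (\<otimes>) (\<phi> [^] Suc i) ` carrier R = (\<otimes>) (\<phi> [^] i) ` carrier R"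
proof -
  obtain d where d: "\<And>i::nat. dimension (d i) K ((\<otimes>) (\<phi> [^] i) ` carrier R)"
    by (rule power_image_dimension[OF assms that])
  obtain i where "\<And>j. d i \<le> d j"
    using ex_has_least_nat[of "\<lambda>_. True" 0 d] by auto
  then have "d (Suc i) = d i"
    using subspace_dimension_le(1)[OF K d d power_image_Suc(2)[OF \<phi>]] by (simp add: le_antisym)
  then show ?thesis
    using subspace_dimension_le(2)[OF K d d power_image_Suc(2)[OF \<phi>]] by blast
qed

text \<open>The relation \<open>d i = k i + d (Suc i)\<close> telescopes from \<open>d 0 = m\<close>
  to \<open>d r = 0\<close>, so \<open>m\<close> is the sum of the \<open>k i\<close> for
  \<open>i < r\<close>, each at most \<open>t\<close>. Equality therefore means that every
  \<open>k i\<close> equals \<open>t\<close>.\<close>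

lemma nilpotent_dimension:
  assumes K: "subfield K R" and \<phi>: "\<phi> \<in> carrier R" and m: "dimension m K (carrier R)"
    and t: "dimension t K {x \<in> carrier R. \<phi> \<otimes> x = \<zero>}"
    and r: "r \<ge> 1" and nil: "\<phi> [^] r = \<zero>"
  shows "m \<le> r * t"
    and "m = r * t \<longleftrightarrow> {x \<in> carrier R. \<phi> \<otimes> x = \<zero>} = (\<otimes>) (\<phi> [^] (r - 1)) ` carrier R"
proof -
  let ?E = "\<lambda>i. (\<otimes>) (\<phi> [^] i) ` carrier R" and ?Z = "{x \<in> carrier R. \<phi> \<otimes> x = \<zero>}"
  obtain d k where d0: "d 0 = m" and d: "\<And>i::nat. dimension (d i) K (?E i)"
    and k: "\<And>i. dimension (k i) K {x \<in> ?E i. \<phi> \<otimes> x = \<zero>}" and dk: "\<And>i. d i = k i + d (Suc i)"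
    by (rule power_image_dimension[OF K \<phi> m that])
  have sub: "{x \<in> ?E i. \<phi> \<otimes> x = \<zero>} \<subseteq> ?Z" for i :: nat using \<phi> by auto
  have kt: "k i \<le> t" for i by (rule subspace_dimension_le(1)[OF K k t sub])
  have "?E r = {\<zero>}" using nil by auto
  then have "d r = 0" using d[of r] zero_dim dimension_is_inj[OF K] by metis
  moreover have "m = (\<Sum>i<j. k i) + d j" for j
    by (induction j) (auto simp: d0 dk[symmetric] add.assoc)
  ultimately have m_sum: "m = (\<Sum>i<r. k i)" by (metis add_0_right)
  then show "m \<le> r * t" using sum_bounded_above[of "{..<r}" k t] kt by simp
  obtain s where s: "r = Suc s" using r by (cases r) auto
  have Es: "?E s \<subseteq> ?Z"
  proof safe
    fix x assume x: "x \<in> carrier R"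
    have "\<phi> \<otimes> (\<phi> [^] s \<otimes> x) = \<phi> [^] r \<otimes> x"
      using \<phi> x by (simp add: s m_ac)
    then show "\<phi> \<otimes> (\<phi> [^] s \<otimes> x) = \<zero>" using nil x by simp
  qed (use \<phi> in auto)
  show "m = r * t \<longleftrightarrow> ?Z = ?E (r - 1)"
  proof
    assume "m = r * t"
    \<comment> \<open>The first \<open>s = r - 1\<close> summands contribute at most
      \<open>s * t\<close>, so the last one has to be all of \<open>t\<close>.\<close>
    moreover have "(\<Sum>i<s. k i) \<le> s * t"
      using sum_bounded_above[of "{..<s}" k t] kt by simp
    ultimately have "k s = t" using m_sum kt[of s] by (simp add: s)
    then have "{x \<in> ?E s. \<phi> \<otimes> x = \<zero>} = ?Z"
      using subspace_dimension_le(2)[OF K k t sub] by blast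
    then show "?Z = ?E (r - 1)" using Es by (auto simp: s)
  next
    assume Z: "?Z = ?E (r - 1)"
    \<comment> \<open>As the images decrease, each of them up to index \<open>r - 1\<close> contains
      the last one, which is the whole kernel.\<close>
    have "k i = t" if "i < r" for i
    proof -
      have "i \<le> s" using that s by simp
      then have "?E s \<subseteq> ?E i"
        by (rule dec_induct) (use power_image_Suc(2)[OF \<phi>] in blast)+
      then have "{x \<in> ?E i. \<phi> \<otimes> x = \<zero>} = ?Z" using Z sub[of i] s by auto
      then show ?thesis using k[of i] t dimension_is_inj[OF K] by metis
    qed
    then show "m = r * t" using m_sum by simp
  qed
qed

end

section \<open>Quotients of the ring of germs\<close>

interpretation germ: cring \<O>
  by (rule cring_germ_ring)

lemma germ_ring_simps [simp]:
  "carrier \<O> = UNIV" "\<one>\<^bsub>\<O>\<^esub> = 1" "\<zero>\<^bsub>\<O>\<^esub> = 0" "x \<otimes>\<^bsub>\<O>\<^esub> y = x * y" "x \<oplus>\<^bsub>\<O>\<^esub> y = x + y"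
  by (simp_all add: germ_ring_def)

lemma germ_ring_uminus [simp]: "\<ominus>\<^bsub>\<O>\<^esub> x = - x"
  by (rule germ.minus_equality) auto

lemma germ_ring_pow [simp]: "x [^]\<^bsub>\<O>\<^esub> (n::nat) = x ^ n"
  by (induction n) (auto simp: mult.commute)

lemma germ_const_hom:
  "germ_const 0 = 0" "germ_const 1 = 1" "germ_const (a + b) = germ_const a + germ_const b"
  "germ_const (a * b) = germ_const a * germ_const b" "germ_const (- a) = - germ_const a"
  by (transfer; simp add: germ_rel_def multi_analytic_at_const)+

lemma germ_value_hom:
  "germ_value 1 = 1" "germ_value (x - y) = germ_value x - germ_value y"
  "germ_value (x * y) = germ_value x * germ_value y"
  by (transfer; simp)+

text \<open>This copy of the complex numbers maps onto the scalars \<open>quot_scalars I\<close> of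
  each quotient.\<close>

lemma subfield_germ_const: "subfield (range germ_const) (\<O> :: 'n::finite germ ring)"
proof (rule germ.subfieldI)
  show "subcring (range germ_const) (\<O> :: 'n germ ring)"
    by (intro germ.subcringI germ.subringI)
       (auto simp: mult.commute simp flip: germ_const_hom)
  show "Units (\<O>\<lparr>carrier := range germ_const\<rparr>) = range germ_const - {\<zero>\<^bsub>\<O> :: 'n germ ring\<^esub>}"
  proof (intro Set.set_eqI iffI)
    fix u :: "'n germ" assume "u \<in> range germ_const - {\<zero>\<^bsub>\<O>\<^esub>}"
    then obtain k where k: "u = germ_const k" and "germ_const k \<noteq> (0 :: 'n germ)" by auto
    then have "k \<noteq> 0" by (auto simp: germ_const_hom)
    then have "germ_const (1 / k) * u = 1" "u * germ_const (1 / k) = 1"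
      by (simp_all add: k germ_const_hom(2) flip: germ_const_hom(4))
    with k show "u \<in> Units (\<O>\<lparr>carrier := range germ_const\<rparr>)"
      unfolding Units_def by auto
  qed (auto simp: Units_def)
qed

lemma quot_carrier: "carrier (\<O> Quot I) = range ((+>\<^bsub>\<O>\<^esub>) I)"
  unfolding FactRing_def A_RCOSETS_def' by auto

lemma quot_zero: "\<zero>\<^bsub>\<O> Quot I\<^esub> = I"
  by (simp add: FactRing_def)

lemma germ_ideal_dest:
  assumes "ideal I (\<O> :: 'n::finite germ ring)"
  shows "0 \<in> I" "x \<in> I \<Longrightarrow> y \<in> I \<Longrightarrow> x + y \<in> I" "x \<in> I \<Longrightarrow> - x \<in> I" "x \<in> I \<Longrightarrow> a * x \<in> I"
    "x \<in> I \<Longrightarrow> x * a \<in> I"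
proof -
  interpret ideal I \<O> by fact
  show "0 \<in> I" "x \<in> I \<Longrightarrow> y \<in> I \<Longrightarrow> x + y \<in> I" "x \<in> I \<Longrightarrow> - x \<in> I" "x \<in> I \<Longrightarrow> a * x \<in> I"
    "x \<in> I \<Longrightarrow> x * a \<in> I"
    using zero_closed a_closed[of x y] a_inv_closed[of x] I_l_closed[of x a] I_r_closed[of x a] by auto
qed

lemma germ_coset: "I +>\<^bsub>\<O>\<^esub> a = (\<lambda>i. i + a) ` I"
  by (auto simp: a_r_coset_def')

context
  fixes I :: "'n::finite germ set"
  assumes I: "ideal I \<O>"
begin

lemma coset_eq_iff: "I +>\<^bsub>\<O>\<^esub> a = I +>\<^bsub>\<O>\<^esub> b \<longleftrightarrow> a - b \<in> I"
proof
  assume "I +>\<^bsub>\<O>\<^esub> a = I +>\<^bsub>\<O>\<^esub> b"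
  then have "0 + a \<in> (\<lambda>i. i + b) ` I"
    unfolding germ_coset using germ_ideal_dest(1)[OF I] by blast
  then show "a - b \<in> I" by auto
next
  assume ab: "a - b \<in> I"
  have "i + a \<in> (\<lambda>i. i + b) ` I" "i + b \<in> (\<lambda>i. i + a) ` I" if "i \<in> I" for i
  proof -
    show "i + a \<in> (\<lambda>i. i + b) ` I"
      using germ_ideal_dest(2)[OF I that ab] by (intro image_eqI[of _ _ "i + (a - b)"]) auto
    show "i + b \<in> (\<lambda>i. i + a) ` I"
      using germ_ideal_dest(2)[OF I that germ_ideal_dest(3)[OF I ab]]
      by (intro image_eqI[of _ _ "i + - (a - b)"]) auto
  qed
  then show "I +>\<^bsub>\<O>\<^esub> a = I +>\<^bsub>\<O>\<^esub> b"
    unfolding germ_coset by blast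
qed

lemma coset_0: "I +>\<^bsub>\<O>\<^esub> 0 = I"
  by (simp add: germ_coset)

lemma coset_eq_ideal_iff: "I +>\<^bsub>\<O>\<^esub> a = I \<longleftrightarrow> a \<in> I"
  using coset_eq_iff[of a 0] by (simp add: coset_0)

lemma quot_mult_coset: "(I +>\<^bsub>\<O>\<^esub> a) \<otimes>\<^bsub>\<O> Quot I\<^esub> (I +>\<^bsub>\<O>\<^esub> b) = I +>\<^bsub>\<O>\<^esub> (a * b)"
  using ideal.rcoset_mult_add[OF I, of a b] by (simp add: FactRing_def)

lemma quot_add_coset: "(I +>\<^bsub>\<O>\<^esub> a) \<oplus>\<^bsub>\<O> Quot I\<^esub> (I +>\<^bsub>\<O>\<^esub> b) = I +>\<^bsub>\<O>\<^esub> (a + b)"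
  using ring_hom_add[OF ideal.rcos_ring_hom[OF I], of a b] by simp

lemma quot_pow_coset: "(I +>\<^bsub>\<O>\<^esub> a) [^]\<^bsub>\<O> Quot I\<^esub> (n::nat) = I +>\<^bsub>\<O>\<^esub> (a ^ n)"
proof -
  interpret ring_hom_ring \<O> "\<O> Quot I" "(+>\<^bsub>\<O>\<^esub>) I"
    by (rule ideal.rcos_ring_hom_ring[OF I])
  show ?thesis using hom_nat_pow[of a n] by simp
qed

text \<open>A union over a coset of a set-valued function that is constant there collapses to a
  single value. This evaluates on representatives both \<open>quot_mult\<close> and the projection
  between two quotients.\<close>

lemma coset_image:
  assumes "\<And>a b. a - b \<in> I \<Longrightarrow> F a = F b"
  shows "(\<Union>g\<in>I +>\<^bsub>\<O>\<^esub> a. F g) = F a"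
proof -
  have "F (i + a) = F a" if "i \<in> I" for i using assms[of "i + a" a] that by simp
  then show ?thesis using germ_ideal_dest(1)[OF I] by (auto simp: germ_coset)
qed

lemma quot_mult_eq:
  assumes "C \<in> carrier (\<O> Quot I)"
  shows "quot_mult \<O> I f C = (I +>\<^bsub>\<O>\<^esub> f) \<otimes>\<^bsub>\<O> Quot I\<^esub> C"
proof -
  obtain a where C: "C = I +>\<^bsub>\<O>\<^esub> a" using assms by (auto simp: quot_carrier)
  have "quot_mult \<O> I f C = I +>\<^bsub>\<O>\<^esub> (f * a)"
    unfolding quot_mult_def C
    by (subst coset_image) (auto simp: coset_eq_iff germ_ideal_dest[OF I] simp flip: right_diff_distrib)
  then show ?thesis by (simp add: C quot_mult_coset)
qed

text \<open>A ring homomorphism carries a subfield to a subfield as soon as the target is not the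
  zero ring, which \<open>1 \<notin> I\<close> guarantees.\<close>

lemma subfield_quot_scalars:
  assumes "1 \<notin> I"
  shows "subfield (quot_scalars I) (\<O> Quot I)"
proof -
  interpret ring_hom_ring \<O> "\<O> Quot I" "(+>\<^bsub>\<O>\<^esub>) I"
    by (rule ideal.rcos_ring_hom_ring[OF I])
  have "\<one>\<^bsub>\<O> Quot I\<^esub> \<noteq> \<zero>\<^bsub>\<O> Quot I\<^esub>"
    using assms by (simp add: FactRing_def coset_eq_ideal_iff)
  from img_is_subfield(2)[OF subfield_germ_const this] show ?thesis
    by (simp add: quot_scalars_def image_image)
qed

lemma quot_dim_eqI:
  assumes "1 \<notin> I" and "ring.dimension (\<O> Quot I) n (quot_scalars I) (carrier (\<O> Quot I))"
  shows "quot_dim I = enat n"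
proof -
  interpret Q: ring "\<O> Quot I" by (rule ideal.quotient_is_ring[OF I])
  show ?thesis
    using Q.dimI[OF subfield_quot_scalars[OF assms(1)] assms(2)] Q.finite_dimensionI[OF assms(2)]
    by (simp add: quot_dim_def over_def)
qed

lemma quot_dim_finiteE:
  assumes "quot_dim I < \<infinity>"
  obtains n where "ring.dimension (\<O> Quot I) n (quot_scalars I) (carrier (\<O> Quot I))"
proof -
  interpret Q: ring "\<O> Quot I" by (rule ideal.quotient_is_ring[OF I])
  show thesis
    using assms that by (auto simp: quot_dim_def Q.finite_dimension_def split: if_splits)
qed

end

lemma quot_dim_UNIV: "quot_dim (UNIV :: 'n::finite germ set) = 0"
proof -
  have I: "ideal (UNIV :: 'n germ set) \<O>" using germ.oneideal by simp
  interpret Q: ring "\<O> Quot (UNIV :: 'n germ set)" by (rule ideal.quotient_is_ring[OF I])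
  let ?A = "\<O> Quot (UNIV :: 'n germ set)"
  have "(UNIV :: 'n germ set) +>\<^bsub>\<O>\<^esub> a = UNIV" for a
    by (simp add: coset_eq_ideal_iff[OF I])
  then have carr: "carrier ?A = {\<zero>\<^bsub>?A\<^esub>}"
    by (simp add: quot_carrier quot_zero)
  have "E = {\<zero>\<^bsub>?A\<^esub>} \<and> n = 0" if "Q.dimension n K E" for n K E
    using that by (induction rule: Q.dimension.induct) (auto simp: carr)
  moreover have "Q.dimension 0 (quot_scalars UNIV) (carrier ?A)"
    unfolding carr by (rule Q.zero_dim)
  ultimately have "Q.dim (quot_scalars UNIV) (carrier ?A) = 0" "Q.finite_dimension (quot_scalars UNIV) (carrier ?A)"
    unfolding Q.dim_def Q.finite_dimension_def by (blast intro: the_equality)+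
  then show ?thesis by (simp add: quot_dim_def zero_enat_def)
qed

section \<open>Nilpotency of a germ modulo an ideal of finite codimension\<close>

lemma one_in_ideal_iff:
  assumes "ideal I (\<O> :: 'n::finite germ ring)"
  shows "1 \<in> I \<longleftrightarrow> I = UNIV"
  using germ_ideal_dest(4)[OF assms, of 1] by fastforce

lemma principal_plus_eq: "PIdl\<^bsub>\<O>\<^esub> f <+>\<^bsub>\<O>\<^esub> J = {a * f + j |a j. j \<in> J}"
  unfolding set_add_def' cgenideal_def by auto

lemma principal_plus_ideal:
  assumes "ideal J (\<O> :: 'n::finite germ ring)"
  shows "ideal (PIdl\<^bsub>\<O>\<^esub> f <+>\<^bsub>\<O>\<^esub> J) \<O>"
  using germ.add_ideals[OF germ.cgenideal_ideal assms, of f] by simp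

text \<open>The germ \<open>1 - f * a\<close> takes the value 1 at the origin, so it is a unit and
  can be cancelled. The condition \<open>f(0) = 0\<close> enters the proof through this
  lemma.\<close>

lemma value_one_in_ideal:
  assumes J: "ideal J (\<O> :: 'n::finite germ ring)" and f: "germ_value f = 0" and "h * (1 - f * a) \<in> J"
  shows "h \<in> J"
proof -
  have "germ_value (1 - f * a) \<noteq> 0" using f by (simp add: germ_value_hom)
  then obtain v where v: "(1 - f * a) * v = 1" using germ_value_nonzero_imp_unit by blast
  have "h * (1 - f * a) * v \<in> J" by (rule germ_ideal_dest(5)[OF J assms(3)])
  then show ?thesis by (simp add: mult.assoc v)
qed

lemma exists_power_in_ideal:
  assumes J: "ideal J (\<O> :: 'n::finite germ ring)" and f: "germ_value f = 0" and "quot_dim J < \<infinity>"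
  shows "\<exists>r\<ge>1. f ^ r \<in> J"
proof (cases "1 \<in> J")
  case True
  then have "f ^ 1 \<in> J" using one_in_ideal_iff[OF J] by simp
  then show ?thesis by blast
next
  case False
  let ?A = "\<O> Quot J" and ?\<phi> = "J +>\<^bsub>\<O>\<^esub> f"
  interpret A: cring ?A by (rule ideal.quotient_is_cring[OF J cring_germ_ring])
  obtain m where m: "A.dimension m (quot_scalars J) (carrier ?A)"
    by (rule quot_dim_finiteE[OF J assms(3)])
  have "?\<phi> \<in> carrier ?A" by (simp add: quot_carrier)
  from A.power_image_stabilises[OF subfield_quot_scalars[OF J False] this m] obtain i :: nat
    where i: "(\<otimes>\<^bsub>?A\<^esub>) (?\<phi> [^]\<^bsub>?A\<^esub> Suc i) ` carrier ?A = (\<otimes>\<^bsub>?A\<^esub>) (?\<phi> [^]\<^bsub>?A\<^esub> i) ` carrier ?A"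
    by blast
  \<comment> \<open>The class of \<open>f ^ i\<close> is the image of 1 under the
    \<open>i\<close>-th power; by stabilisation it is also a multiple of the class of
    \<open>f ^ Suc i\<close>.\<close>
  have "J +>\<^bsub>\<O>\<^esub> f ^ i \<in> (\<otimes>\<^bsub>?A\<^esub>) (?\<phi> [^]\<^bsub>?A\<^esub> Suc i) ` carrier ?A"
    unfolding i by (rule image_eqI[of _ _ "J +>\<^bsub>\<O>\<^esub> 1"]) (auto simp: quot_pow_coset[OF J] quot_mult_coset[OF J] quot_carrier)
  then have "J +>\<^bsub>\<O>\<^esub> f ^ i \<in> range (\<lambda>a. J +>\<^bsub>\<O>\<^esub> (f ^ Suc i * a))"
    unfolding quot_carrier image_image quot_pow_coset[OF J] quot_mult_coset[OF J] .
  then obtain a where "J +>\<^bsub>\<O>\<^esub> f ^ i = J +>\<^bsub>\<O>\<^esub> (f ^ Suc i * a)" by blast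
  then have "f ^ i - f ^ Suc i * a \<in> J" by (simp add: coset_eq_iff[OF J])
  then have "f ^ i * (1 - f * a) \<in> J" by (simp add: algebra_simps)
  then have "f ^ i \<in> J" by (rule value_one_in_ideal[OF J f])
  \<comment> \<open>One more factor makes the exponent at least 1 without separating the case
    \<open>i = 0\<close>.\<close>
  then have "f ^ Suc i \<in> J" using germ_ideal_dest(4)[OF J] by simp
  then show ?thesis by (metis le_add1 plus_1_eq_Suc)
qed

section \<open>Kernel, image and cokernel of multiplication by a germ\<close>

lemma quot_ideal_principal_plus:
  assumes J: "ideal J (\<O> :: 'n::finite germ ring)"
  shows "quot_ideal \<O> (PIdl\<^bsub>\<O>\<^esub> f <+>\<^bsub>\<O>\<^esub> J) J = (\<otimes>\<^bsub>\<O> Quot J\<^esub>) (J +>\<^bsub>\<O>\<^esub> f) ` carrier (\<O> Quot J)"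
proof -
  \<comment> \<open>The summand from \<open>J\<close> disappears in the quotient, which leaves
    exactly the multiples of the class of \<open>f\<close>.\<close>
  have "J +>\<^bsub>\<O>\<^esub> (a * f + j) = J +>\<^bsub>\<O>\<^esub> (f * a)" if "j \<in> J" for a j
    using that by (simp add: coset_eq_iff[OF J] mult.commute)
  moreover have "J +>\<^bsub>\<O>\<^esub> (f * a) = J +>\<^bsub>\<O>\<^esub> (a * f + 0)" for a by (simp add: mult.commute)
  ultimately show ?thesis
    unfolding quot_ideal_def principal_plus_eq quot_carrier image_image quot_mult_coset[OF J]
    using germ_ideal_dest(1)[OF J] by (auto simp: image_iff)
qed

lemma kernel_quot_mult:
  assumes J: "ideal J (\<O> :: 'n::finite germ ring)"
  shows "a_kernel (\<O> Quot J) (\<O> Quot J) (quot_mult \<O> J f) =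
    {x \<in> carrier (\<O> Quot J). (J +>\<^bsub>\<O>\<^esub> f) \<otimes>\<^bsub>\<O> Quot J\<^esub> x = \<zero>\<^bsub>\<O> Quot J\<^esub>}"
  using quot_mult_eq[OF J] by (auto simp: a_kernel_def')

text \<open>Rank-nullity is applied twice to \<open>A = \<O> / J\<close>: to the projection onto the
  quotient by the larger ideal, whose kernel is \<open>\<phi> A\<close>, and to
  \<open>\<phi>\<close> itself, whose image is \<open>\<phi> A\<close>. Both remaining dimensions
  are \<open>m\<close> minus the dimension of \<open>\<phi> A\<close>.\<close>

lemma quot_dim_principal_plus:
  assumes J: "ideal J (\<O> :: 'n::finite germ ring)" and nJ: "1 \<notin> J" and f: "germ_value f = 0"
    and m: "ring.dimension (\<O> Quot J) m (quot_scalars J) (carrier (\<O> Quot J))"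
  shows "\<exists>t. ring.dimension (\<O> Quot J) t (quot_scalars J)
      {x \<in> carrier (\<O> Quot J). (J +>\<^bsub>\<O>\<^esub> f) \<otimes>\<^bsub>\<O> Quot J\<^esub> x = \<zero>\<^bsub>\<O> Quot J\<^esub>}
    \<and> quot_dim (PIdl\<^bsub>\<O>\<^esub> f <+>\<^bsub>\<O>\<^esub> J) = enat t"
proof -
  define I where "I = PIdl\<^bsub>\<O>\<^esub> f <+>\<^bsub>\<O>\<^esub> J"
  have I: "ideal I \<O>" unfolding I_def by (rule principal_plus_ideal[OF J])
  have JI: "J \<subseteq> I"
  proof
    fix j assume "j \<in> J"
    then have "0 * f + j \<in> I" unfolding I_def principal_plus_eq by blast
    then show "j \<in> I" by simp
  qed
  \<comment> \<open>Otherwise \<open>J\<close> would contain the unit \<open>1 - f * a\<close>.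
    Properness of \<open>I\<close> makes the scalars of the second quotient a subfield.\<close>
  have nI: "1 \<notin> I"
  proof
    assume "1 \<in> I"
    then obtain a j where aj: "1 = a * f + j" "j \<in> J" by (auto simp: I_def principal_plus_eq)
    then have "j = 1 * (1 - f * a)" by (simp add: algebra_simps)
    then have "1 \<in> J" using aj(2) value_one_in_ideal[OF J f] by metis
    with nJ show False ..
  qed
  let ?A = "\<O> Quot J" and ?B = "\<O> Quot I" and ?\<phi> = "J +>\<^bsub>\<O>\<^esub> f"
  interpret A: cring ?A by (rule ideal.quotient_is_cring[OF J cring_germ_ring])
  interpret B: cring ?B by (rule ideal.quotient_is_cring[OF I cring_germ_ring])
  have K: "subfield (quot_scalars J) ?A" by (rule subfield_quot_scalars[OF J nJ])
  \<comment> \<open>The projection from \<open>\<O> / J\<close> to \<open>\<O> / I\<close>. It also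
    carries one copy of the scalars to the other, so below it serves as \<open>\<sigma>\<close>
    too.\<close>
  define T where "T = (\<lambda>C. \<Union>g\<in>C. I +>\<^bsub>\<O>\<^esub> g)"
  have T: "T (J +>\<^bsub>\<O>\<^esub> a) = I +>\<^bsub>\<O>\<^esub> a" for a
    unfolding T_def using JI by (intro coset_image[OF J]) (auto simp: coset_eq_iff[OF I])
  have "\<exists>p q. A.dimension p (quot_scalars J) {x \<in> carrier ?A. T x = \<zero>\<^bsub>?B\<^esub>} \<and>
      B.dimension q (quot_scalars I) (T ` carrier ?A) \<and> m = p + q"
  proof (rule dimension_semilinear[where \<sigma> = T, OF A.ring_axioms B.ring_axioms K _ _ _ _ m])
    show "T ` quot_scalars J = quot_scalars I"
      by (simp add: quot_scalars_def image_image T)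
    show "T (k \<otimes>\<^bsub>?A\<^esub> x) = T k \<otimes>\<^bsub>?B\<^esub> T x" if "k \<in> quot_scalars J" "x \<in> carrier ?A" for k x
      using that by (auto simp: quot_scalars_def quot_carrier T quot_mult_coset[OF J] quot_mult_coset[OF I])
  qed (auto simp: quot_carrier T quot_add_coset[OF J] quot_add_coset[OF I])
  then obtain p q where p: "A.dimension p (quot_scalars J) {x \<in> carrier ?A. T x = \<zero>\<^bsub>?B\<^esub>}"
    and q: "B.dimension q (quot_scalars I) (T ` carrier ?A)" and mpq: "m = p + q"
    by blast
  have "T ` carrier ?A = carrier ?B" by (simp add: quot_carrier image_image T)
  with q have dim_I: "quot_dim I = enat q" using quot_dim_eqI[OF I nI] by simp
  have "T (J +>\<^bsub>\<O>\<^esub> a) = \<zero>\<^bsub>?B\<^esub> \<longleftrightarrow> a \<in> I" for a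
    by (simp add: T quot_zero coset_eq_ideal_iff[OF I])
  then have "{x \<in> carrier ?A. T x = \<zero>\<^bsub>?B\<^esub>} = (+>\<^bsub>\<O>\<^esub>) J ` I"
    unfolding quot_carrier by blast
  also have "\<dots> = (\<otimes>\<^bsub>?A\<^esub>) ?\<phi> ` carrier ?A"
    using quot_ideal_principal_plus[OF J, of f] by (simp add: quot_ideal_def I_def)
  finally have p': "A.dimension p (quot_scalars J) ((\<otimes>\<^bsub>?A\<^esub>) ?\<phi> ` carrier ?A)" using p by simp
  have "?\<phi> \<in> carrier ?A" by (simp add: quot_carrier)
  from A.dimension_mult[OF K this m] obtain t p2
    where t: "A.dimension t (quot_scalars J) {x \<in> carrier ?A. ?\<phi> \<otimes>\<^bsub>?A\<^esub> x = \<zero>\<^bsub>?A\<^esub>}"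
      and p2: "A.dimension p2 (quot_scalars J) ((\<otimes>\<^bsub>?A\<^esub>) ?\<phi> ` carrier ?A)" and "m = t + p2"
    by blast
  with mpq A.dimension_is_inj[OF K p' p2] have "t = q" by simp
  with t dim_I show ?thesis by (auto simp: I_def)
qed

text \<open>The result for an ideal of finite codimension, stated with natural numbers and a
  product, so that it covers dimension 0 as well.\<close>

lemma quot_dim_power_bound:
  assumes J: "ideal J (\<O> :: 'n::finite germ ring)" and f: "germ_value f = 0" and fin: "quot_dim J < \<infinity>"
    and r: "r \<ge> 1" "f ^ r \<in> J"
  obtains m t where "quot_dim J = enat m" and "quot_dim (PIdl\<^bsub>\<O>\<^esub> f <+>\<^bsub>\<O>\<^esub> J) = enat t"
    and "m \<le> r * t"
    and "m = r * t \<longleftrightarrow> a_kernel (\<O> Quot J) (\<O> Quot J) (quot_mult \<O> J f) =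
          quot_ideal \<O> (PIdl\<^bsub>\<O>\<^esub> (f ^ (r - 1)) <+>\<^bsub>\<O>\<^esub> J) J"
proof (cases "1 \<in> J")
  \<comment> \<open>The zero quotient has to be treated apart, since its scalars form no subfield:
    both dimensions are 0, and kernel and ideal both consist of the single class
    \<open>J\<close>.\<close>
  case True
  then have JU: "J = UNIV" using one_in_ideal_iff[OF J] by simp
  have "x = 0 * f + x" for x by simp
  then have sum: "PIdl\<^bsub>\<O>\<^esub> f <+>\<^bsub>\<O>\<^esub> J = UNIV"
    unfolding principal_plus_eq JU by blast
  have coset: "J +>\<^bsub>\<O>\<^esub> a = J" for a
    using coset_eq_ideal_iff[OF J, of a] by (simp add: JU)
  then have carr: "carrier (\<O> Quot J) = {J}"
    by (simp add: quot_carrier)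
  have mult: "(J +>\<^bsub>\<O>\<^esub> g) \<otimes>\<^bsub>\<O> Quot J\<^esub> J = J" for g
    using quot_mult_coset[OF J, of g 0] by (simp add: coset)
  have "quot_dim J = enat 0" "quot_dim (PIdl\<^bsub>\<O>\<^esub> f <+>\<^bsub>\<O>\<^esub> J) = enat 0"
    unfolding sum by (simp_all add: JU quot_dim_UNIV zero_enat_def)
  moreover have "a_kernel (\<O> Quot J) (\<O> Quot J) (quot_mult \<O> J f) =
      quot_ideal \<O> (PIdl\<^bsub>\<O>\<^esub> (f ^ (r - 1)) <+>\<^bsub>\<O>\<^esub> J) J"
    unfolding kernel_quot_mult[OF J] quot_ideal_principal_plus[OF J] carr
    by (auto simp: mult quot_zero)
  ultimately show thesis
    using that[of 0 0] by simp
next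
  case False
  let ?A = "\<O> Quot J" and ?\<phi> = "J +>\<^bsub>\<O>\<^esub> f"
  interpret A: cring ?A by (rule ideal.quotient_is_cring[OF J cring_germ_ring])
  obtain m where m: "A.dimension m (quot_scalars J) (carrier ?A)"
    by (rule quot_dim_finiteE[OF J fin])
  obtain t where t: "A.dimension t (quot_scalars J) {x \<in> carrier ?A. ?\<phi> \<otimes>\<^bsub>?A\<^esub> x = \<zero>\<^bsub>?A\<^esub>}"
    and dim_t: "quot_dim (PIdl\<^bsub>\<O>\<^esub> f <+>\<^bsub>\<O>\<^esub> J) = enat t"
    using quot_dim_principal_plus[OF J False f m] by blast
  have \<phi>: "?\<phi> \<in> carrier ?A" by (simp add: quot_carrier)
  have nil: "?\<phi> [^]\<^bsub>?A\<^esub> r = \<zero>\<^bsub>?A\<^esub>"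
    using r(2) by (simp add: quot_pow_coset[OF J] quot_zero coset_eq_ideal_iff[OF J])
  note bound = A.nilpotent_dimension[OF subfield_quot_scalars[OF J False] \<phi> m t r(1) nil]
  show thesis
  proof (rule that)
    show "quot_dim J = enat m" by (rule quot_dim_eqI[OF J False m])
    show "m = r * t \<longleftrightarrow> a_kernel ?A ?A (quot_mult \<O> J f) =
        quot_ideal \<O> (PIdl\<^bsub>\<O>\<^esub> (f ^ (r - 1)) <+>\<^bsub>\<O>\<^esub> J) J"
      using bound(2)
      by (simp add: kernel_quot_mult[OF J] quot_ideal_principal_plus[OF J] quot_pow_coset[OF J])
  qed (use dim_t bound(1) in auto)
qed


section \<open>The ratio of the Bruce-Roberts Milnor and Tjurina numbers\<close>

theorem corollary3p3:
  fixes U X :: "(complex ^ 'n::finite) set" and f :: "'n germ"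
  assumes "open U" and "0 \<in> U" and "analytic_subvariety U X"
    and "germ_value f = 0"
    and "milnor X f < \<infinity>"
  defines "J \<equiv> bruce_roberts_ideal X f"
  shows "\<exists>r :: nat. power_index \<O> f J = enat r \<and>
    (tjurina X f \<noteq> 0 \<longrightarrow>
       ereal_of_enat (milnor X f) / ereal_of_enat (tjurina X f) \<le> ereal_of_enat r \<and>
       (ereal_of_enat (milnor X f) / ereal_of_enat (tjurina X f) = ereal_of_enat r \<longleftrightarrow>
          a_kernel (\<O> Quot J) (\<O> Quot J) (quot_mult \<O> J f) =
          quot_ideal \<O> (PIdl\<^bsub>\<O>\<^esub> (f [^]\<^bsub>\<O>\<^esub> (r - 1)) <+>\<^bsub>\<O>\<^esub> J) J)) \<and>
    milnor X f \<le> enat r * tjurina X f \<and>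
    (milnor X f = enat r * tjurina X f \<longleftrightarrow>
       a_kernel (\<O> Quot J) (\<O> Quot J) (quot_mult \<O> J f) =
       quot_ideal \<O> (PIdl\<^bsub>\<O>\<^esub> (f [^]\<^bsub>\<O>\<^esub> (r - 1)) <+>\<^bsub>\<O>\<^esub> J) J)"
proof -
  have J: "ideal J \<O>"
    unfolding J_def bruce_roberts_ideal_def by (rule germ.genideal_ideal) simp
  have fin: "quot_dim J < \<infinity>" using assms(5) by (simp add: milnor_def J_def)
  define r where "r = (LEAST r. r \<ge> 1 \<and> f ^ r \<in> J)"
  have r: "r \<ge> 1" "f ^ r \<in> J" and least: "\<And>s. s \<ge> 1 \<Longrightarrow> f ^ s \<in> J \<Longrightarrow> r \<le> s"
    using LeastI_ex[OF exists_power_in_ideal[OF J assms(4) fin]]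
    by (auto simp: r_def intro: Least_le)
  have index: "power_index \<O> f J = enat r"
    unfolding power_index_def
  proof (rule antisym)
    show "Inf {enat r |r::nat. r \<ge> 1 \<and> f [^]\<^bsub>\<O>\<^esub> r \<in> J} \<le> enat r"
      using r by (intro Inf_lower) auto
    show "enat r \<le> Inf {enat r |r::nat. r \<ge> 1 \<and> f [^]\<^bsub>\<O>\<^esub> r \<in> J}"
      using least by (intro Inf_greatest) auto
  qed
  obtain m t where m: "milnor X f = enat m" and t: "tjurina X f = enat t"
    and le: "m \<le> r * t"
    and eq: "m = r * t \<longleftrightarrow> a_kernel (\<O> Quot J) (\<O> Quot J) (quot_mult \<O> J f) =
          quot_ideal \<O> (PIdl\<^bsub>\<O>\<^esub> (f ^ (r - 1)) <+>\<^bsub>\<O>\<^esub> J) J"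
    unfolding milnor_def tjurina_def J_def[symmetric]
    by (rule quot_dim_power_bound[OF J assms(4) fin r])
  \<comment> \<open>The fraction is formed only for \<open>t \<noteq> 0\<close>. For
    \<open>t = 0\<close> the inequality \<open>m \<le> r * t\<close> forces \<open>m = 0\<close>,
    and the product form of the claim still speaks about this case.\<close>
  have "ereal_of_enat (milnor X f) / ereal_of_enat (tjurina X f) = ereal (real m / real t)"
    and "real m / real t \<le> real r" and "real m / real t = real r \<longleftrightarrow> m = r * t"
    if "tjurina X f \<noteq> 0"
    using that le
    by (simp_all add: m t zero_enat_def divide_le_eq divide_eq_eq flip: of_nat_mult)
  then show ?thesis
    using index le eq by (intro exI[of _ r]) (simp add: m t)
qed

end
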